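(* Let $n\ge 2$, let $M,N\in\mathbb{Z}^{n-1}$ and let $D=(D_1,\dots,D_{n-1})$ be a tuple of positive integers. The long Weyl element Kloosterman sums satisfy: (i) If $n\ge3$ and $D_1=1$, then $S_n(M,N;D)=S_{n-1}((M_2,\dots,M_{n-1}),(N_2,\dots,N_{n-1});(D_2,\dots,D_{n-1}))$. (ii) If $2\le i\le n-1$ and $D_i,\dots,D_{n-1}$ are all equal to $1$, then $S_n(M,N;D)=S_i((M_1,\dots,M_{i-1}),(N_1,\dots,N_{i-1});(D_1,\dots,D_{i-1}))$. (iii) If $1\le i\le n-2$ and $D_1,\dots,D_i$ are all equal to $1$, then $S_n(M,N;D)=S_{n-i}((M_{i+1},\dots,M_{n-1}),(N_{i+1},\dots,N_{n-1});(D_{i+1},\dots,D_{n-1}))$. (iv) If $1\le i$, $i+2\le j\le n-1$ and $D_1,\dots,D_i$ and $D_j,\dots,D_{n-1}$ are all equal to $1$, then $S_n(M,N;D)=S_{j-i}((M_{i+1},\dots,M_{j-1}),(N_{i+1},\dots,N_{j-1});(D_{i+1},\dots,D_{j-1}))$. (v) If $1\le i\le n-1$ and $D_j=1$ for all $j\ne i$, then $S_n(M,N;D)=S_2(M_i,N_i;D_i)$.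
   Context: Definition of $S_n(M,N;D)$ for any $n\ge2$, $M,N\in\mathbb{Z}^{n-1}$ and $D$ an $(n-1)$-tuple of positive integers: $e(z)=e^{2\pi i z}$. $U$ is the group of upper triangular unipotent $n\times n$ matrices. For $N\in\mathbb{Z}^{n-1}$, $\psi_N$ is the character of $U(\mathbb{R})$, trivial on $U(\mathbb{Z})$, given by $\psi_N(u)=e(N_1u_{1,2}+N_2u_{2,3}+\cdots+N_{n-1}u_{n-1,n})$. For $M\in \mathbb{Z}^{n-1}$, $\tilde M=(M_{n-1},\dots,M_1)$. Let $w_0$ be the long Weyl element: the $n\times n$ matrix whose only nonzero entries are on the anti-diagonal, the entry at position $(n-k+1,k)$ being $(-1)^{k-1}$ ($1\le k\le n$). Let $c=\mathrm{Diag}(1/D_{n-1},\,D_{n-1}/D_{n-2},\dots,D_2/D_1,\,D_1)$, $C(c)=U(\mathbb{R})\,c\,w_0\,U(\mathbb{R})\cap SL(n,\mathbb{Z})$ and $X(c)=U(\mathbb{Z})\backslash C(c)/U(\mathbb{Z})$. Each $\gamma\in C(c)$ is uniquely $\gamma=b_1cw_0b_2$ with $b_1,b_2\in U(\mathbb{R})$; set $\mu(\gamma)=b_1\in U(\mathbb{Z})\backslash U(\mathbb{R})$ and $\mu'(\gamma)=b_2\in U(\mathbb{R})/U(\mathbb{Z})$. Then $$S_n(M,N;D)=\sum_{x\in X(c)}\psi_{\tilde M}(\mu(x))\,\psi_N(\mu'(x)).$$ For $n=2$ the arguments are integers (1-tuples). *)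

theory Defs
  imports Complex_Main "Jordan_Normal_Form.Determinant"
begin

text \<open>
  Matrices are those of \<open>Jordan_Normal_Form\<close>, so that the size \<open>n\<close> is a natural number;
  their indices start at 0. A tuple \<open>(X\<^sub>1, \<dots>, X\<^sub>m)\<close> is a list of length \<open>m\<close>; its entries are
  addressed below with indices starting at 1.
\<close>

definition entry :: "'a list \<Rightarrow> nat \<Rightarrow> 'a" where
  "entry X k = X ! (k - 1)"

text \<open>\<open>subtuple X a b\<close> is \<open>(X\<^sub>a, X\<^sub>a\<^sub>+\<^sub>1, \<dots>, X\<^sub>b)\<close>, both ends included.\<close>

definition subtuple :: "'a list \<Rightarrow> nat \<Rightarrow> nat \<Rightarrow> 'a list" where
  "subtuple X a b = map (entry X) [a..<Suc b]"

definition e_char :: "real \<Rightarrow> complex" where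
  "e_char z = exp (2 * complex_of_real pi * \<i> * complex_of_real z)"

definition U_real :: "nat \<Rightarrow> real mat set" where
  "U_real n = {u \<in> carrier_mat n n. upper_triangular u \<and> (\<forall>i<n. u $$ (i, i) = 1)}"

definition U_int :: "nat \<Rightarrow> real mat set" where
  "U_int n = {u \<in> U_real n. elements_mat u \<subseteq> \<int>}"

definition SL_int :: "nat \<Rightarrow> real mat set" where
  "SL_int n = {g \<in> carrier_mat n n. elements_mat g \<subseteq> \<int> \<and> det g = 1}"

text \<open>The superdiagonal entry \<open>u\<^sub>k\<^sub>,\<^sub>k\<^sub>+\<^sub>1\<close> is \<open>u $$ (k - 1, k)\<close> in 0-based indices.\<close>

definition psi :: "nat \<Rightarrow> int list \<Rightarrow> real mat \<Rightarrow> complex" where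
  "psi n N u = e_char (\<Sum>k = 1..n - 1. of_int (entry N k) * u $$ (k - 1, k))"

text \<open>
  The 1-based position \<open>(n - k + 1, k)\<close>, with entry \<open>(-1)\<^sup>k\<^sup>-\<^sup>1\<close>, is \<open>(n - 1 - j, j)\<close> with entry
  \<open>(-1)\<^sup>j\<close> for \<open>j = k - 1\<close>.
\<close>

definition w_long :: "nat \<Rightarrow> real mat" where
  "w_long n = mat n n (\<lambda>(i, j). if i + j = n - 1 then (- 1) ^ j else 0)"

text \<open>
  \<open>Diag(1/D\<^sub>n\<^sub>-\<^sub>1, D\<^sub>n\<^sub>-\<^sub>1/D\<^sub>n\<^sub>-\<^sub>2, \<dots>, D\<^sub>2/D\<^sub>1, D\<^sub>1)\<close>: with the convention \<open>D\<^sub>0 = D\<^sub>n = 1\<close>, the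
  diagonal entry with 0-based index \<open>i\<close> is \<open>D\<^sub>n\<^sub>-\<^sub>i / D\<^sub>n\<^sub>-\<^sub>i\<^sub>-\<^sub>1\<close>.
\<close>

definition c_diag :: "nat \<Rightarrow> int list \<Rightarrow> real mat" where
  "c_diag n D =
     (let d = (\<lambda>k. if k = 0 \<or> k = n then 1 else real_of_int (entry D k))
      in mat_diag n (\<lambda>i. d (n - i) / d (n - i - 1)))"

definition bruhat_cell :: "nat \<Rightarrow> real mat \<Rightarrow> real mat set" where
  "bruhat_cell n c =
     {b1 * c * w_long n * b2 | b1 b2. b1 \<in> U_real n \<and> b2 \<in> U_real n} \<inter> SL_int n"

definition double_coset :: "nat \<Rightarrow> real mat \<Rightarrow> real mat set" where
  "double_coset n g = {u * g * v | u v. u \<in> U_int n \<and> v \<in> U_int n}"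

definition X_cosets :: "nat \<Rightarrow> real mat \<Rightarrow> real mat set set" where
  "X_cosets n c = double_coset n ` bruhat_cell n c"

text \<open>
  The two unipotent factors of \<open>g = b1 * c * w_long n * b2\<close>, which are unique for \<open>g\<close> in the cell
  when \<open>c\<close> is an invertible diagonal matrix.
\<close>

definition mu :: "nat \<Rightarrow> real mat \<Rightarrow> real mat \<Rightarrow> real mat" where
  "mu n c g = (THE b1. b1 \<in> U_real n \<and> (\<exists>b2 \<in> U_real n. g = b1 * c * w_long n * b2))"

definition mu' :: "nat \<Rightarrow> real mat \<Rightarrow> real mat \<Rightarrow> real mat" where
  "mu' n c g = (THE b2. b2 \<in> U_real n \<and> (\<exists>b1 \<in> U_real n. g = b1 * c * w_long n * b2))"

text \<open>
  The summand is evaluated at a representative \<open>g\<close> of the double coset \<open>x\<close>. The choice is immaterial: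
  replacing \<open>g\<close> by \<open>u * g * v\<close> with \<open>u\<close>, \<open>v\<close> integral unipotent replaces \<open>mu n c g\<close> by
  \<open>u * mu n c g\<close> and \<open>mu' n c g\<close> by \<open>mu' n c g * v\<close>, and the characters \<open>psi n N\<close> are trivial on
  integral matrices. The reversed tuple \<open>rev M\<close> is \<open>(M\<^sub>n\<^sub>-\<^sub>1, \<dots>, M\<^sub>1)\<close>.
\<close>

definition kloosterman :: "nat \<Rightarrow> int list \<Rightarrow> int list \<Rightarrow> int list \<Rightarrow> complex" where
  "kloosterman n M N D =
     (let c = c_diag n D
      in \<Sum>x \<in> X_cosets n c.
           let g = (SOME g. g \<in> x) in psi n (rev M) (mu n c g) * psi n N (mu' n c g))"

end

theory Submission
  imports Defs
begin

text \<open>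
  An element of the cell is \<open>g = b\<^sub>1 c w b\<^sub>2\<close>, and its first column and last row are \<open>D\<^sub>1\<close> times the last
  column of \<open>b\<^sub>1\<close> and the first row of \<open>b\<^sub>2\<close>. So if \<open>D\<^sub>1 = 1\<close> these are integral and can be removed by
  integral unipotent factors; what is left is \<open>g'\<close> bordered as \<open>[[0, -g'], [1, 0]]\<close>, with \<open>g'\<close> in the
  cell of \<open>(D\<^sub>2, \<dots>, D\<^sub>n\<^sub>-\<^sub>1)\<close>. Bordering thus induces a bijection of the double coset spaces, and the
  superdiagonals of the unipotent factors only gain a zero. If \<open>D\<^sub>n\<^sub>-\<^sub>1 = 1\<close> the same holds for
  \<open>[[0, \<plusminus>1], [g', 0]]\<close>; here integrality of the factors to be removed uses the inverse of the
  integral lower left block, whose determinant is 1. Removing entries at both ends one at a time gives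
  all five identities. As the sums are matched by a bijection, the junk value 0 of a sum over an
  infinite set does no harm.
\<close>

subsection \<open>Integral and unipotent matrices\<close>

lemma elements_mat_subset_iff:
  assumes "A \<in> carrier_mat r s"
  shows "elements_mat A \<subseteq> S \<longleftrightarrow> (\<forall>i<r. \<forall>j<s. A $$ (i, j) \<in> S)"
  using assms elements_matI[OF assms] by (auto dest!: elements_matD)

lemma elements_four_block_mat_subset_iff:
  assumes "A \<in> carrier_mat r1 s1" "B \<in> carrier_mat r1 s2"
    "C \<in> carrier_mat r2 s1" "D \<in> carrier_mat r2 s2"
  shows "elements_mat (four_block_mat A B C D) \<subseteq> S \<longleftrightarrow>
    elements_mat A \<subseteq> S \<and> elements_mat B \<subseteq> S \<and> elements_mat C \<subseteq> S \<and> elements_mat D \<subseteq> S"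
    (is "?L \<longleftrightarrow> ?R")
proof
  assume ?L
  then have *: "four_block_mat A B C D $$ (i, j) \<in> S" if "i < r1 + r2" "j < s1 + s2" for i j
    using that elements_mat_subset_iff[OF four_block_carrier_mat[OF assms(1,4)]] by blast
  have "A $$ (i, j) \<in> S" if "i < r1" "j < s1" for i j
    using *[of i j] that assms by auto
  moreover have "B $$ (i, j) \<in> S" if "i < r1" "j < s2" for i j
    using *[of i "s1 + j"] that assms by auto
  moreover have "C $$ (i, j) \<in> S" if "i < r2" "j < s1" for i j
    using *[of "r1 + i" j] that assms by auto
  moreover have "D $$ (i, j) \<in> S" if "i < r2" "j < s2" for i j
    using *[of "r1 + i" "s1 + j"] that assms by auto
  ultimately show ?R
    using assms by (simp add: elements_mat_subset_iff)
next
  assume ?R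
  then show ?L
    using elements_four_block_mat[OF assms] by blast
qed

lemma four_block_mat_eq_iff:
  assumes "A \<in> carrier_mat r1 s1" "B \<in> carrier_mat r1 s2"
    "C \<in> carrier_mat r2 s1" "D \<in> carrier_mat r2 s2"
    "A' \<in> carrier_mat r1 s1" "B' \<in> carrier_mat r1 s2"
    "C' \<in> carrier_mat r2 s1" "D' \<in> carrier_mat r2 s2"
  shows "four_block_mat A B C D = four_block_mat A' B' C' D' \<longleftrightarrow>
    A = A' \<and> B = B' \<and> C = C' \<and> D = D'"
    (is "?L \<longleftrightarrow> ?R")
proof
  assume ?L
  then have *: "four_block_mat A B C D $$ (i, j) = four_block_mat A' B' C' D' $$ (i, j)" for i j
    by simp
  have "A = A'"
  proof (rule eq_matI)
    fix i j assume "i < dim_row A'" "j < dim_col A'"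
    then show "A $$ (i, j) = A' $$ (i, j)" using *[of i j] assms by auto
  qed (use assms in auto)
  moreover have "B = B'"
  proof (rule eq_matI)
    fix i j assume "i < dim_row B'" "j < dim_col B'"
    then show "B $$ (i, j) = B' $$ (i, j)" using *[of i "s1 + j"] assms by auto
  qed (use assms in auto)
  moreover have "C = C'"
  proof (rule eq_matI)
    fix i j assume "i < dim_row C'" "j < dim_col C'"
    then show "C $$ (i, j) = C' $$ (i, j)" using *[of "r1 + i" j] assms by auto
  qed (use assms in auto)
  moreover have "D = D'"
  proof (rule eq_matI)
    fix i j assume "i < dim_row D'" "j < dim_col D'"
    then show "D $$ (i, j) = D' $$ (i, j)" using *[of "r1 + i" "s1 + j"] assms by auto
  qed (use assms in auto)
  ultimately show ?R by blast
qed simp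

lemma elements_mat_mult_Ints:
  fixes A B :: "'a :: comm_ring_1 mat"
  assumes "A \<in> carrier_mat r s" "B \<in> carrier_mat s t"
    and "elements_mat A \<subseteq> \<int>" "elements_mat B \<subseteq> \<int>"
  shows "elements_mat (A * B) \<subseteq> \<int>"
proof -
  have "(A * B) $$ (i, j) \<in> \<int>" if "i < r" "j < t" for i j
    using that assms elements_mat_subset_iff[OF assms(1)] elements_mat_subset_iff[OF assms(2)]
    by (auto simp: scalar_prod_def intro!: Ints_sum Ints_mult)
  then show ?thesis
    using elements_mat_subset_iff[OF mult_carrier_mat[OF assms(1,2)]] by blast
qed

lemma elements_mat_uminus_Ints:
  fixes A :: "'a :: comm_ring_1 mat"
  assumes "A \<in> carrier_mat r s" "elements_mat A \<subseteq> \<int>"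
  shows "elements_mat (- A) \<subseteq> \<int>"
  using assms by (simp add: elements_mat_subset_iff)

lemma elements_one_mat_Ints: "elements_mat (1\<^sub>m n :: 'a :: ring_1 mat) \<subseteq> \<int>"
  by (subst elements_mat_subset_iff[of _ n n]) auto

lemma elements_zero_mat_Ints: "elements_mat (0\<^sub>m r s :: 'a :: ring_1 mat) \<subseteq> \<int>"
  by (subst elements_mat_subset_iff[of _ r s]) auto

lemma det_Ints:
  fixes A :: "'a :: comm_ring_1 mat"
  assumes "A \<in> carrier_mat n n" "elements_mat A \<subseteq> \<int>"
  shows "det A \<in> \<int>"
proof -
  have "A $$ (i, p i) \<in> \<int>" if "p permutes {0..<n}" "i < n" for p i
    using that assms(2) permutes_in_image[OF that(1), of i]
    by (auto simp: elements_mat_subset_iff[OF assms(1)])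
  then show ?thesis
    unfolding det_def'[OF assms(1)]
    by (intro Ints_sum Ints_mult Ints_prod) (auto simp: sign_def)
qed

text \<open>The adjugate is the inverse because the determinant is 1, and its entries are integers
  because every cofactor is, up to sign, the determinant of an integral minor.\<close>

lemma SL_int_inverse:
  assumes "g \<in> SL_int n"
  obtains h where "h \<in> carrier_mat n n" "elements_mat h \<subseteq> \<int>" "g * h = 1\<^sub>m n" "h * g = 1\<^sub>m n"
proof
  have g: "g \<in> carrier_mat n n" "elements_mat g \<subseteq> \<int>" "det g = 1"
    using assms by (auto simp: SL_int_def)
  note adj = adj_mat[OF g(1)]
  show "adj_mat g \<in> carrier_mat n n" "g * adj_mat g = 1\<^sub>m n" "adj_mat g * g = 1\<^sub>m n"
    using adj g(3) by auto
  have "cofactor g j i \<in> \<int>" if "i < n" "j < n" for i j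
  proof -
    have "elements_mat (mat_delete g j i) \<subseteq> \<int>"
      using that g by (subst elements_mat_subset_iff[of _ "n - 1" "n - 1"])
        (auto simp: mat_delete_def elements_mat_subset_iff)
    moreover have "mat_delete g j i \<in> carrier_mat (n - 1) (n - 1)"
      using g(1) by (rule mat_delete_carrier)
    ultimately show ?thesis
      by (auto simp: cofactor_def intro!: Ints_mult det_Ints)
  qed
  then show "elements_mat (adj_mat g) \<subseteq> \<int>"
    using adj(1) g(1) by (simp add: elements_mat_subset_iff) (simp add: adj_mat_def)
qed

section \<open>Upper triangular unipotent matrices and their products\<close>

lemma U_real_iff:
  "u \<in> U_real n \<longleftrightarrow> u \<in> carrier_mat n n \<and> (\<forall>i<n. u $$ (i, i) = 1) \<and> (\<forall>i<n. \<forall>j<i. u $$ (i, j) = 0)"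
  by (auto simp: U_real_def upper_triangular_def)

lemma U_real_carrier: "u \<in> U_real n \<Longrightarrow> u \<in> carrier_mat n n"
  by (simp add: U_real_iff)

lemma U_int_U_real: "u \<in> U_int n \<Longrightarrow> u \<in> U_real n"
  by (simp add: U_int_def)

lemma det_U_real:
  assumes "u \<in> U_real n"
  shows "det u = 1"
proof -
  have "prod_list (diag_mat u) = (\<Prod>i<n. 1)"
    unfolding prod_list_diag_prod using assms by (intro prod.cong) (auto simp: U_real_iff)
  then show ?thesis
    using assms by (subst det_upper_triangular[of _ n]) (auto simp: U_real_def)
qed

lemma one_mat_U_int: "1\<^sub>m n \<in> U_int n"
  by (auto simp: U_int_def U_real_iff dest: set_mp[OF elements_one_mat_Ints])

text \<open>Triangularity kills the terms with \<open>k < i\<close> in the first factor and with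
  \<open>k > j\<close> in the second. The case \<open>j = i + 1\<close> leaves two terms, which is
  what makes \<open>psi\<close> multiplicative.\<close>

lemma U_real_mult_index:
  assumes "u \<in> U_real n" "v \<in> U_real n" "i < n" "j < n"
  shows "(u * v) $$ (i, j) = (\<Sum>k = i..j. u $$ (i, k) * v $$ (k, j))"
proof -
  have "(u * v) $$ (i, j) = (\<Sum>k = 0..<n. u $$ (i, k) * v $$ (k, j))"
    using assms by (auto simp: U_real_iff scalar_prod_def intro!: sum.cong)
  also have "\<dots> = (\<Sum>k = i..j. u $$ (i, k) * v $$ (k, j))"
    using assms by (intro sum.mono_neutral_right) (auto simp: U_real_iff not_le)
  finally show ?thesis .
qed

lemma U_real_mult: "u \<in> U_real n \<Longrightarrow> v \<in> U_real n \<Longrightarrow> u * v \<in> U_real n"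
  using U_real_mult_index[of u n v] by (auto simp: U_real_iff)

lemma U_int_mult: "u \<in> U_int n \<Longrightarrow> v \<in> U_int n \<Longrightarrow> u * v \<in> U_int n"
  unfolding U_int_def
  by (auto simp: U_real_mult dest: set_mp[OF elements_mat_mult_Ints[OF U_real_carrier U_real_carrier]])

section \<open>Characters of the unipotent group\<close>

lemma e_char_add: "e_char (x + y) = e_char x * e_char y"
  by (simp add: e_char_def distrib_left exp_add)

lemma e_char_Ints: "x \<in> \<int> \<Longrightarrow> e_char x = 1"
  using cis_multiple_2pi[of x] by (simp add: e_char_def cis_conv_exp mult.commute mult.left_commute)

lemma psi_mult:
  assumes "u \<in> U_real n" "v \<in> U_real n"
  shows "psi n N (u * v) = psi n N u * psi n N v"
proof -
  \<comment> \<open>The superdiagonal is additive: only two terms survive, and each contains a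
    diagonal entry 1.\<close>
  have "(u * v) $$ (k - 1, k) = u $$ (k - 1, k) + v $$ (k - 1, k)" if "k \<in> {1..n - 1}" for k
  proof -
    have "{k - 1..k} = {k - 1, k}" "k - 1 \<noteq> k" "k - 1 < n" "k < n" using that by auto
    then show ?thesis using assms U_real_mult_index[OF assms, of "k - 1" k] by (simp add: U_real_iff)
  qed
  then have "(\<Sum>k = 1..n - 1. of_int (entry N k) * (u * v) $$ (k - 1, k)) =
      (\<Sum>k = 1..n - 1. of_int (entry N k) * u $$ (k - 1, k) + of_int (entry N k) * v $$ (k - 1, k))"
    by (intro sum.cong) (simp_all add: distrib_left)
  then show ?thesis
    by (simp add: psi_def sum.distrib flip: e_char_add)
qed

lemma psi_U_int: "u \<in> U_int n \<Longrightarrow> psi n N u = 1"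
  unfolding psi_def U_int_def
  by (intro e_char_Ints Ints_sum Ints_mult) (auto simp: elements_mat_subset_iff[OF U_real_carrier])

section \<open>Splitting off the first row or the last column of a unipotent matrix\<close>

definition front_block :: "nat \<Rightarrow> real mat \<Rightarrow> real mat \<Rightarrow> real mat" where
  "front_block m p b = four_block_mat (1\<^sub>m 1) p (0\<^sub>m m 1) b"

definition back_block :: "nat \<Rightarrow> real mat \<Rightarrow> real mat \<Rightarrow> real mat" where
  "back_block m b p = four_block_mat b p (0\<^sub>m 1 m) (1\<^sub>m 1)"

lemma front_block_U_real:
  "p \<in> carrier_mat 1 m \<Longrightarrow> b \<in> U_real m \<Longrightarrow> front_block m p b \<in> U_real (Suc m)"
  unfolding front_block_def U_real_iff by auto

lemma back_block_U_real:
  "p \<in> carrier_mat m 1 \<Longrightarrow> b \<in> U_real m \<Longrightarrow> back_block m b p \<in> U_real (Suc m)"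
  unfolding back_block_def U_real_iff by (auto simp: less_Suc_eq)

lemma elements_front_block:
  "p \<in> carrier_mat 1 m \<Longrightarrow> b \<in> carrier_mat m m \<Longrightarrow>
    elements_mat (front_block m p b) \<subseteq> \<int> \<longleftrightarrow> elements_mat p \<subseteq> \<int> \<and> elements_mat b \<subseteq> \<int>"
  unfolding front_block_def
  by (subst elements_four_block_mat_subset_iff[of _ 1 1 _ m _ m])
    (auto simp: elements_one_mat_Ints elements_zero_mat_Ints[of m 1])

lemma elements_back_block:
  "p \<in> carrier_mat m 1 \<Longrightarrow> b \<in> carrier_mat m m \<Longrightarrow>
    elements_mat (back_block m b p) \<subseteq> \<int> \<longleftrightarrow> elements_mat p \<subseteq> \<int> \<and> elements_mat b \<subseteq> \<int>"
  unfolding back_block_def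
  by (subst elements_four_block_mat_subset_iff[of _ m m _ 1 _ 1])
    (auto simp: elements_one_mat_Ints elements_zero_mat_Ints)

lemma front_block_U_int:
  "p \<in> carrier_mat 1 m \<Longrightarrow> elements_mat p \<subseteq> \<int> \<Longrightarrow> b \<in> U_int m \<Longrightarrow> front_block m p b \<in> U_int (Suc m)"
  using elements_front_block[of p m b] by (simp add: U_int_def front_block_U_real U_real_carrier)

lemma back_block_U_int:
  "p \<in> carrier_mat m 1 \<Longrightarrow> elements_mat p \<subseteq> \<int> \<Longrightarrow> b \<in> U_int m \<Longrightarrow> back_block m b p \<in> U_int (Suc m)"
  using elements_back_block[of p m b] by (simp add: U_int_def back_block_U_real U_real_carrier)

lemma U_real_front_blockE:
  assumes "u \<in> U_real (Suc m)"
  obtains p b where "u = front_block m p b" "p \<in> carrier_mat 1 m" "b \<in> U_real m"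
proof
  show "u = front_block m (mat 1 m (\<lambda>(i, j). u $$ (0, Suc j))) (mat m m (\<lambda>(i, j). u $$ (Suc i, Suc j)))"
    using assms by (intro eq_matI) (auto simp: front_block_def U_real_iff)
  show "mat m m (\<lambda>(i, j). u $$ (Suc i, Suc j)) \<in> U_real m"
    using assms by (auto simp: U_real_iff)
qed auto

lemma U_real_back_blockE:
  assumes "u \<in> U_real (Suc m)"
  obtains b p where "u = back_block m b p" "p \<in> carrier_mat m 1" "b \<in> U_real m"
proof
  show "u = back_block m (mat m m (\<lambda>(i, j). u $$ (i, j))) (mat m 1 (\<lambda>(i, j). u $$ (i, m)))"
    using assms by (intro eq_matI) (auto simp: back_block_def U_real_iff less_Suc_eq)
  show "mat m m (\<lambda>(i, j). u $$ (i, j)) \<in> U_real m"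
    using assms by (auto simp: U_real_iff)
qed auto

lemma front_block_mult:
  assumes "p \<in> carrier_mat 1 m" "q \<in> carrier_mat 1 m" "a \<in> carrier_mat m m" "b \<in> carrier_mat m m"
  shows "front_block m p a * front_block m q b = front_block m (q + p * b) (a * b)"
  unfolding front_block_def using assms
  by (subst mult_four_block_mat[of _ 1 1 _ m _ m _ _ 1 _ m]) auto

lemma back_block_mult:
  assumes "p \<in> carrier_mat m 1" "q \<in> carrier_mat m 1" "a \<in> carrier_mat m m" "b \<in> carrier_mat m m"
  shows "back_block m a p * back_block m b q = back_block m (a * b) (a * q + p)"
  unfolding back_block_def using assms
  by (subst mult_four_block_mat[of _ m m _ 1 _ 1 _ _ m _ 1]) auto

text \<open>Induction on the size, splitting off the first row. Integrality is carried along as an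
  implication, so that one induction serves both the real and the integral group.\<close>

lemma U_real_inverse_Ints:
  assumes "u \<in> U_real n"
  obtains v where "v \<in> U_real n" "u * v = 1\<^sub>m n" "v * u = 1\<^sub>m n"
    "elements_mat u \<subseteq> \<int> \<longrightarrow> elements_mat v \<subseteq> \<int>"
proof -
  have "\<exists>v\<in>U_real n. u * v = 1\<^sub>m n \<and> (elements_mat u \<subseteq> \<int> \<longrightarrow> elements_mat v \<subseteq> \<int>)"
    using assms
  proof (induction n arbitrary: u)
    case 0
    then show ?case
      by (intro bexI[of _ u]) (auto simp: U_real_iff)
  next
    case (Suc m)
    obtain p b where u: "u = front_block m p b" and p: "p \<in> carrier_mat 1 m" and b: "b \<in> U_real m"
      using Suc.prems by (rule U_real_front_blockE)
    obtain a where a: "a \<in> U_real m" "b * a = 1\<^sub>m m" "elements_mat b \<subseteq> \<int> \<longrightarrow> elements_mat a \<subseteq> \<int>"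
      using Suc.IH[OF b] by blast
    note carriers = p U_real_carrier[OF a(1)] U_real_carrier[OF b]
    have pa: "p * a \<in> carrier_mat 1 m" by (rule mult_carrier_mat[OF p U_real_carrier[OF a(1)]])
    \<comment> \<open>The inverse by blocks: the off-diagonal row of \<open>u * ?v\<close> is
      \<open>- (p * a) + p * a\<close>. No division occurs, so integrality of \<open>p\<close> and
      \<open>a\<close> passes to \<open>?v\<close>.\<close>
    let ?v = "front_block m (- (p * a)) a"
    have "front_block m (0\<^sub>m 1 m) (1\<^sub>m m) = 1\<^sub>m (Suc m)"
      by (rule eq_matI) (auto simp: front_block_def)
    then have "u * ?v = 1\<^sub>m (Suc m)"
      unfolding u using a(2) pa carriers
      by (subst front_block_mult) (auto simp: uminus_l_inv_mat[OF pa] simp del: One_nat_def)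
    moreover have "elements_mat ?v \<subseteq> \<int>" if "elements_mat u \<subseteq> \<int>"
      using that a(3) pa carriers unfolding u
      by (simp add: elements_front_block elements_mat_uminus_Ints[OF pa] elements_mat_mult_Ints[of p 1 m a m])
    moreover have "?v \<in> U_real (Suc m)"
      using a pa by (intro front_block_U_real) auto
    ultimately show ?case by blast
  qed
  then obtain v where v: "v \<in> U_real n" "u * v = 1\<^sub>m n" "elements_mat u \<subseteq> \<int> \<longrightarrow> elements_mat v \<subseteq> \<int>"
    by blast
  have "v * u = 1\<^sub>m n"
    using v assms by (intro mat_mult_left_right_inverse[of u n v] U_real_carrier)
  with v show thesis using that[of v] by simp
qed

lemma U_real_inverse:
  assumes "u \<in> U_real n"
  obtains v where "v \<in> U_real n" "u * v = 1\<^sub>m n" "v * u = 1\<^sub>m n"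
  by (rule U_real_inverse_Ints[OF assms])

lemma U_int_inverse:
  assumes "u \<in> U_int n"
  obtains v where "v \<in> U_int n" "u * v = 1\<^sub>m n" "v * u = 1\<^sub>m n"
proof -
  have u: "u \<in> U_real n" "elements_mat u \<subseteq> \<int>"
    using assms by (auto simp: U_int_def)
  obtain v where "v \<in> U_real n" "u * v = 1\<^sub>m n" "v * u = 1\<^sub>m n"
    "elements_mat u \<subseteq> \<int> \<longrightarrow> elements_mat v \<subseteq> \<int>"
    using U_real_inverse_Ints[OF u(1)] .
  then show thesis
    using that[of v] u(2) by (simp add: U_int_def)
qed

subsection \<open>Uniqueness of the Bruhat factors and independence of the representative\<close>

lemma index_mult_mat_sum:
  assumes "A \<in> carrier_mat r s" "B \<in> carrier_mat s t" "i < r" "j < t"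
  shows "(A * B) $$ (i, j) = (\<Sum>k = 0..<s. A $$ (i, k) * B $$ (k, j))"
  using assms by (auto simp: scalar_prod_def intro!: sum.cong)

lemma mat_diag_w_long_index:
  assumes "i < n" "j < n"
  shows "(mat_diag n f * w_long n) $$ (i, j) = (if i + j = n - 1 then f i * (- 1) ^ j else 0)"
  using assms by (subst mat_diag_mult_left[of _ n n]) (auto simp: w_long_def)

lemma mat_diag_w_long_carrier: "mat_diag n f * w_long n \<in> carrier_mat n n"
  by (rule mult_carrier_mat[of _ n n]) (auto simp: w_long_def)

lemma mult_mat_diag_w_long_index:
  assumes "x \<in> carrier_mat n n" "i < n" "j < n"
  shows "(x * (mat_diag n f * w_long n)) $$ (i, j) = x $$ (i, n - 1 - j) * (f (n - 1 - j) * (- 1) ^ j)"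
proof -
  have "(x * (mat_diag n f * w_long n)) $$ (i, j) =
      (\<Sum>k = 0..<n. x $$ (i, k) * (mat_diag n f * w_long n) $$ (k, j))"
    using assms mat_diag_w_long_carrier by (intro index_mult_mat_sum[of _ n n _ n])
  also have "\<dots> = (\<Sum>k = 0..<n. if k = n - 1 - j then x $$ (i, k) * (f k * (- 1) ^ j) else 0)"
    using assms by (intro sum.cong) (auto simp: mat_diag_w_long_index simp del: index_mult_mat(1))
  also have "\<dots> = x $$ (i, n - 1 - j) * (f (n - 1 - j) * (- 1) ^ j)"
    using assms by (subst sum.delta) auto
  finally show ?thesis .
qed

lemma mat_diag_w_long_mult_index:
  assumes "y \<in> carrier_mat n n" "i < n" "j < n"
  shows "(mat_diag n f * w_long n * y) $$ (i, j) = f i * (- 1) ^ (n - 1 - i) * y $$ (n - 1 - i, j)"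
proof -
  have "(mat_diag n f * w_long n * y) $$ (i, j) =
      (\<Sum>k = 0..<n. (mat_diag n f * w_long n) $$ (i, k) * y $$ (k, j))"
    using assms mat_diag_w_long_carrier by (intro index_mult_mat_sum[of _ n n _ n])
  also have "\<dots> = (\<Sum>k = 0..<n. if k = n - 1 - i then f i * (- 1) ^ k * y $$ (k, j) else 0)"
    using assms by (intro sum.cong) (auto simp: mat_diag_w_long_index simp del: index_mult_mat(1))
  also have "\<dots> = f i * (- 1) ^ (n - 1 - i) * y $$ (n - 1 - i, j)"
    using assms by (subst sum.delta) auto
  finally show ?thesis .
qed

text \<open>Conjugation by an invertible antidiagonal matrix turns upper triangular matrices into
  lower triangular ones. Thus \<open>x\<close> and \<open>y\<close> are triangular in both senses,
  with diagonal 1.\<close>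

lemma U_real_antidiagonal_commute:
  assumes "x \<in> U_real n" "y \<in> U_real n" "\<forall>i<n. f i \<noteq> 0"
    and eq: "x * (mat_diag n f * w_long n) = mat_diag n f * w_long n * y"
  shows "x = 1\<^sub>m n" "y = 1\<^sub>m n"
proof -
  \<comment> \<open>Compare the entries in row \<open>i\<close> and column \<open>n - 1 - k\<close>.
    Reversing both indices exchanges the positions above and below the diagonal, so a zero of
    \<open>y\<close> below it gives a zero of \<open>x\<close> above it, and conversely.\<close>
  have *: "x $$ (i, k) * (f k * (- 1) ^ (n - 1 - k)) = f i * (- 1) ^ (n - 1 - i) * y $$ (n - 1 - i, n - 1 - k)"
    if "i < n" "k < n" for i k
    using that mult_mat_diag_w_long_index[OF U_real_carrier[OF assms(1)], of i "n - 1 - k" f]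
      mat_diag_w_long_mult_index[OF U_real_carrier[OF assms(2)], of i "n - 1 - k" f]
    by (simp add: eq)
  show "x = 1\<^sub>m n"
  proof (rule eq_matI)
    fix i k assume "i < dim_row (1\<^sub>m n :: real mat)" "k < dim_col (1\<^sub>m n :: real mat)"
    then have ik: "i < n" "k < n" by auto
    show "x $$ (i, k) = 1\<^sub>m n $$ (i, k)"
    proof (cases "i < k")
      case True
      then have "y $$ (n - 1 - i, n - 1 - k) = 0" using assms(2) ik by (auto simp: U_real_iff)
      then show ?thesis using *[OF ik] assms(3) ik True by auto
    qed (use assms(1) ik in \<open>auto simp: U_real_iff\<close>)
  qed (use assms(1) in \<open>auto simp: U_real_iff\<close>)
  show "y = 1\<^sub>m n"
  proof (rule eq_matI)
    fix i k assume "i < dim_row (1\<^sub>m n :: real mat)" "k < dim_col (1\<^sub>m n :: real mat)"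
    then have ik: "i < n" "k < n" by auto
    show "y $$ (i, k) = 1\<^sub>m n $$ (i, k)"
    proof (cases "i < k")
      case True
      then have "x $$ (n - 1 - i, n - 1 - k) = 0" using assms(1) ik by (auto simp: U_real_iff)
      then show ?thesis using *[of "n - 1 - i" "n - 1 - k"] assms(3) ik True by auto
    qed (use assms(2) ik in \<open>auto simp: U_real_iff\<close>)
  qed (use assms(2) in \<open>auto simp: U_real_iff\<close>)
qed

text \<open>Multiplying by \<open>v1\<close>, the inverse of \<open>a1\<close>, on the left and by
  \<open>v2\<close>, the inverse of \<open>b2\<close>, on the right brings the equation to the form
  \<open>x * T = T * y\<close> with \<open>x\<close> and \<open>y\<close> unipotent; then both are
  the identity.\<close>

lemma bruhat_unique:
  assumes "a1 \<in> U_real n" "a2 \<in> U_real n" "b1 \<in> U_real n" "b2 \<in> U_real n" "\<forall>i<n. f i \<noteq> 0"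
    and eq: "a1 * (mat_diag n f * w_long n) * a2 = b1 * (mat_diag n f * w_long n) * b2"
  shows "a1 = b1" "a2 = b2"
proof -
  define T where "T = mat_diag n f * w_long n"
  have T: "T \<in> carrier_mat n n" unfolding T_def by (rule mat_diag_w_long_carrier)
  obtain v1 where v1: "v1 \<in> U_real n" "a1 * v1 = 1\<^sub>m n" "v1 * a1 = 1\<^sub>m n"
    by (rule U_real_inverse[OF assms(1)])
  obtain v2 where v2: "v2 \<in> U_real n" "b2 * v2 = 1\<^sub>m n" "v2 * b2 = 1\<^sub>m n"
    by (rule U_real_inverse[OF assms(4)])
  note carr = T assms(1-4)[THEN U_real_carrier] v1(1)[THEN U_real_carrier] v2(1)[THEN U_real_carrier]
  have "v1 * (a1 * T * a2) * v2 = v1 * (b1 * T * b2) * v2" using eq by (simp add: T_def)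
  also have "v1 * (a1 * T * a2) * v2 = (v1 * a1) * T * (a2 * v2)"
    using carr by (simp add: assoc_mult_mat[of _ n n _ n _ n])
  also have "v1 * (b1 * T * b2) * v2 = (v1 * b1) * T * (b2 * v2)"
    using carr by (simp add: assoc_mult_mat[of _ n n _ n _ n])
  finally have "(v1 * b1) * T = T * (a2 * v2)" using carr v1 v2 by simp
  then have *: "v1 * b1 = 1\<^sub>m n" "a2 * v2 = 1\<^sub>m n"
    using U_real_antidiagonal_commute[of "v1 * b1" n "a2 * v2" f] U_real_mult assms v1 v2
    unfolding T_def by auto
  have "b1 = a1 * v1 * b1" using v1 carr by simp
  also have "\<dots> = a1 * (v1 * b1)" using carr by (simp add: assoc_mult_mat[of _ n n _ n _ n])
  finally show "a1 = b1" using * carr by simp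
  have "a2 = a2 * (v2 * b2)" using v2 carr by simp
  also have "\<dots> = (a2 * v2) * b2" using carr by (simp add: assoc_mult_mat[of _ n n _ n _ n])
  finally show "a2 = b2" using * carr by simp
qed

text \<open>Passes from the bracketing in \<open>bruhat_cell\<close> to the one used from here on,
  where the diagonal matrix and the Weyl element form a single antidiagonal matrix.\<close>

lemma bruhat_assoc:
  assumes "b1 \<in> U_real n" "b2 \<in> U_real n"
  shows "b1 * mat_diag n f * w_long n * b2 = b1 * (mat_diag n f * w_long n) * b2"
  using U_real_carrier[OF assms(1)]
  by (subst assoc_mult_mat[of b1 n n _ n _ n]) (auto simp: w_long_def)

lemma bruhat_cellE:
  assumes "g \<in> bruhat_cell n (mat_diag n f)"
  obtains b1 b2 where "b1 \<in> U_real n" "b2 \<in> U_real n" "g = b1 * (mat_diag n f * w_long n) * b2" "g \<in> SL_int n"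
  using assms bruhat_assoc by (auto simp: bruhat_cell_def)

lemma bruhat_cellI:
  "b1 \<in> U_real n \<Longrightarrow> b2 \<in> U_real n \<Longrightarrow> b1 * (mat_diag n f * w_long n) * b2 \<in> SL_int n \<Longrightarrow>
    b1 * (mat_diag n f * w_long n) * b2 \<in> bruhat_cell n (mat_diag n f)"
  using bruhat_assoc[of b1 n b2 f] by (auto simp: bruhat_cell_def) metis

lemma mu_bruhat:
  assumes "b1 \<in> U_real n" "b2 \<in> U_real n" "\<forall>i<n. f i \<noteq> 0"
  shows "mu n (mat_diag n f) (b1 * (mat_diag n f * w_long n) * b2) = b1"
    "mu' n (mat_diag n f) (b1 * (mat_diag n f * w_long n) * b2) = b2"
  unfolding mu_def mu'_def
  by (rule the_equality; use assms bruhat_unique in \<open>fastforce simp: bruhat_assoc\<close>)+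

section \<open>Double cosets modulo the integral unipotent group\<close>

lemma double_cosetI: "u \<in> U_int n \<Longrightarrow> v \<in> U_int n \<Longrightarrow> u * g * v \<in> double_coset n g"
  by (auto simp: double_coset_def)

lemma double_coset_self: "g \<in> carrier_mat n n \<Longrightarrow> g \<in> double_coset n g"
  using double_cosetI[OF one_mat_U_int one_mat_U_int, of n g] by simp

lemma double_coset_mult:
  assumes g: "g \<in> carrier_mat n n" and P: "P \<in> U_int n" and Q: "Q \<in> U_int n"
  shows "double_coset n (P * g * Q) = double_coset n g"
proof -
  have sub: "double_coset n (P * g * Q) \<subseteq> double_coset n g"
    if g: "g \<in> carrier_mat n n" and P: "P \<in> U_int n" and Q: "Q \<in> U_int n" for g P Q
  proof
    fix x assume "x \<in> double_coset n (P * g * Q)"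
    then obtain u v where uv: "u \<in> U_int n" "v \<in> U_int n" and x: "x = u * (P * g * Q) * v"
      by (auto simp: double_coset_def)
    note carr = g P[THEN U_int_U_real, THEN U_real_carrier] Q[THEN U_int_U_real, THEN U_real_carrier]
      uv(1)[THEN U_int_U_real, THEN U_real_carrier] uv(2)[THEN U_int_U_real, THEN U_real_carrier]
    have "x = (u * P) * g * (Q * v)"
      unfolding x using carr by (simp add: assoc_mult_mat[of _ n n _ n _ n])
    then show "x \<in> double_coset n g"
      using P Q uv by (auto intro: double_cosetI U_int_mult)
  qed
  \<comment> \<open>The reverse inclusion is the same one applied to \<open>P * g * Q\<close> with
    the inverses of \<open>P\<close> and \<open>Q\<close>.\<close>
  obtain P' where P': "P' \<in> U_int n" "P' * P = 1\<^sub>m n" by (rule U_int_inverse[OF P])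
  obtain Q' where Q': "Q' \<in> U_int n" "Q * Q' = 1\<^sub>m n" by (rule U_int_inverse[OF Q])
  note carr = g P[THEN U_int_U_real, THEN U_real_carrier] Q[THEN U_int_U_real, THEN U_real_carrier]
    P'(1)[THEN U_int_U_real, THEN U_real_carrier] Q'(1)[THEN U_int_U_real, THEN U_real_carrier]
  have "P' * (P * g * Q) * Q' = (P' * P) * g * (Q * Q')"
    using carr by (simp add: assoc_mult_mat[of _ n n _ n _ n])
  then have "P' * (P * g * Q) * Q' = g" using P' Q' g by simp
  then have "double_coset n g \<subseteq> double_coset n (P * g * Q)"
    using sub[of "P * g * Q" P' Q'] P' Q' carr by simp
  then show ?thesis using sub[OF g P Q] by simp
qed

text \<open>The list \<open>R\<close> takes the place of \<open>rev M\<close>, so that the two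
  characters can be shortened independently.\<close>

definition summand :: "nat \<Rightarrow> int list \<Rightarrow> int list \<Rightarrow> real mat \<Rightarrow> real mat set \<Rightarrow> complex" where
  "summand n R N c x = psi n R (mu n c (SOME g. g \<in> x)) * psi n N (mu' n c (SOME g. g \<in> x))"

lemma kloosterman_summand:
  "kloosterman n M N D = (\<Sum>x\<in>X_cosets n (c_diag n D). summand n (rev M) N (c_diag n D) x)"
  by (simp add: kloosterman_def summand_def Let_def)

text \<open>Whatever representative is chosen, it is \<open>u * (b1 * T * b2) * v\<close> with
  \<open>u\<close> and \<open>v\<close> integral. By uniqueness its factors are
  \<open>u * b1\<close> and \<open>b2 * v\<close>, and the characters do not see \<open>u\<close>
  and \<open>v\<close>.\<close>

lemma summand_double_coset:
  assumes b: "b1 \<in> U_real n" "b2 \<in> U_real n" and f: "\<forall>i<n. f i \<noteq> 0"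
  shows "summand n R N (mat_diag n f) (double_coset n (b1 * (mat_diag n f * w_long n) * b2)) =
    psi n R b1 * psi n N b2"
proof -
  define T where "T = mat_diag n f * w_long n"
  define x where "x = double_coset n (b1 * T * b2)"
  have T: "T \<in> carrier_mat n n" unfolding T_def by (rule mat_diag_w_long_carrier)
  note carr = T b[THEN U_real_carrier]
  have "b1 * T * b2 \<in> x"
    unfolding x_def using carr by (intro double_coset_self) auto
  then have "(SOME g. g \<in> x) \<in> x" by (rule someI)
  then obtain u v where uv: "u \<in> U_int n" "v \<in> U_int n" and eq: "(SOME g. g \<in> x) = u * (b1 * T * b2) * v"
    by (auto simp: x_def double_coset_def)
  note carr = carr uv[THEN U_int_U_real, THEN U_real_carrier]
  have "u * (b1 * T * b2) * v = (u * b1) * T * (b2 * v)"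
    using carr by (simp add: assoc_mult_mat[of _ n n _ n _ n])
  then have "summand n R N (mat_diag n f) x = psi n R (u * b1) * psi n N (b2 * v)"
    unfolding summand_def eq using mu_bruhat[of "u * b1" n "b2 * v" f] U_real_mult b uv f
    by (auto simp: T_def U_int_U_real)
  then show ?thesis
    using uv b by (simp add: x_def T_def psi_mult U_int_U_real psi_U_int)
qed

subsection \<open>Maps between cells of different sizes\<close>

text \<open>What both reductions have in common. The map \<open>\<iota>\<close> carries the small
  cell into the large one and turns left and right multiplication into multiplication through
  \<open>\<alpha>\<close> and \<open>\<beta>\<close>. The assumption \<open>iota_coset\<close> gives
  injectivity on double cosets, \<open>factor\<close> gives surjectivity, and
  \<open>psi_alpha\<close> and \<open>psi_beta\<close> match the summands.\<close>

locale kloosterman_embedding =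
  fixes n m :: nat and f f' :: "nat \<Rightarrow> real" and \<iota> \<alpha> \<beta> :: "real mat \<Rightarrow> real mat"
    and R N R' N' :: "int list"
  assumes nonzero: "\<forall>i<n. f i \<noteq> 0" "\<forall>i<m. f' i \<noteq> 0"
    and alpha_real: "u \<in> U_real m \<Longrightarrow> \<alpha> u \<in> U_real n" and beta_real: "u \<in> U_real m \<Longrightarrow> \<beta> u \<in> U_real n"
    and alpha_int: "u \<in> U_int m \<Longrightarrow> \<alpha> u \<in> U_int n" and beta_int: "u \<in> U_int m \<Longrightarrow> \<beta> u \<in> U_int n"
    and iota_carrier: "g \<in> carrier_mat m m \<Longrightarrow> \<iota> g \<in> carrier_mat n n"
    and iota_mult: "u \<in> U_real m \<Longrightarrow> v \<in> U_real m \<Longrightarrow> g \<in> carrier_mat m m \<Longrightarrow>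
      \<iota> (u * g * v) = \<alpha> u * \<iota> g * \<beta> v"
    and iota_long: "\<iota> (mat_diag m f' * w_long m) = mat_diag n f * w_long n"
    and iota_SL: "g \<in> carrier_mat m m \<Longrightarrow> \<iota> g \<in> SL_int n \<longleftrightarrow> g \<in> SL_int m"
    and iota_coset: "u \<in> U_int n \<Longrightarrow> v \<in> U_int n \<Longrightarrow> g \<in> carrier_mat m m \<Longrightarrow> h \<in> carrier_mat m m \<Longrightarrow>
      \<iota> g = u * \<iota> h * v \<Longrightarrow> g \<in> double_coset m h"
    and factor: "b1 \<in> U_real n \<Longrightarrow> b2 \<in> U_real n \<Longrightarrow> b1 * (mat_diag n f * w_long n) * b2 \<in> SL_int n \<Longrightarrow>
      \<exists>P\<in>U_int n. \<exists>Q\<in>U_int n. \<exists>a1\<in>U_real m. \<exists>a2\<in>U_real m. b1 = P * \<alpha> a1 \<and> b2 = \<beta> a2 * Q"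
    and psi_alpha: "u \<in> U_real m \<Longrightarrow> psi n R (\<alpha> u) = psi m R' u"
    and psi_beta: "u \<in> U_real m \<Longrightarrow> psi n N (\<beta> u) = psi m N' u"
begin

text \<open>The injectivity half. The image of \<open>x\<close> lies in the double coset of
  \<open>\<iota> g\<close>, hence in that of \<open>\<iota> h\<close>, and \<open>iota_coset\<close>
  pulls this back. Exchanging \<open>g\<close> and \<open>h\<close> gives the other
  inclusion.\<close>

lemma iota_double_coset_subset:
  assumes "g \<in> carrier_mat m m" "h \<in> carrier_mat m m"
    and eq: "double_coset n (\<iota> g) = double_coset n (\<iota> h)"
  shows "double_coset m g \<subseteq> double_coset m h"
proof
  fix x assume "x \<in> double_coset m g"
  then obtain u v where uv: "u \<in> U_int m" "v \<in> U_int m" and x: "x = u * g * v"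
    by (auto simp: double_coset_def)
  have "\<iota> x = \<alpha> u * \<iota> g * \<beta> v"
    unfolding x using uv assms by (intro iota_mult U_int_U_real)
  then have "\<iota> x \<in> double_coset n (\<iota> h)"
    using uv by (simp add: double_cosetI alpha_int beta_int flip: eq)
  then obtain u' v' where "u' \<in> U_int n" "v' \<in> U_int n" "\<iota> x = u' * \<iota> h * v'"
    by (auto simp: double_coset_def)
  moreover have "x \<in> carrier_mat m m"
    unfolding x using uv[THEN U_int_U_real, THEN U_real_carrier] assms by auto
  ultimately show "x \<in> double_coset m h"
    using assms by (intro iota_coset)
qed

lemma iota_bruhat:
  assumes "a1 \<in> U_real m" "a2 \<in> U_real m"
  shows "\<iota> (a1 * (mat_diag m f' * w_long m) * a2) = \<alpha> a1 * (mat_diag n f * w_long n) * \<beta> a2"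
  using iota_mult[OF assms mat_diag_w_long_carrier] by (simp add: iota_long)

lemma sum_summand_eq:
  "(\<Sum>x\<in>X_cosets n (mat_diag n f). summand n R N (mat_diag n f) x) =
   (\<Sum>x\<in>X_cosets m (mat_diag m f'). summand m R' N' (mat_diag m f') x)"
proof -
  let ?X = "X_cosets n (mat_diag n f)" and ?X' = "X_cosets m (mat_diag m f')"
  \<comment> \<open>A cell element is selected in each double coset in order to define
    \<open>\<Phi>\<close> on cosets; the fact \<open>\<Phi>\<close> below removes the dependence on
    this selection.\<close>
  define rep where "rep x = (SOME g. g \<in> bruhat_cell m (mat_diag m f') \<and> x = double_coset m g)" for x
  define \<Phi> where "\<Phi> x = double_coset n (\<iota> (rep x))" for x
  have rep: "rep x \<in> bruhat_cell m (mat_diag m f')" "double_coset m (rep x) = x" if "x \<in> ?X'" for x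
    using that someI_ex[of "\<lambda>g. g \<in> bruhat_cell m (mat_diag m f') \<and> x = double_coset m g"]
    unfolding rep_def X_cosets_def by blast+
  have carr: "g \<in> carrier_mat m m" if "g \<in> bruhat_cell m (mat_diag m f')" for g
    using that by (auto simp: bruhat_cell_def SL_int_def)
  have \<Phi>: "\<Phi> (double_coset m g) = double_coset n (\<iota> g)" if g: "g \<in> bruhat_cell m (mat_diag m f')" for g
  proof -
    let ?r = "rep (double_coset m g)"
    have x: "double_coset m g \<in> ?X'" using g by (auto simp: X_cosets_def)
    have "?r \<in> double_coset m g"
      using double_coset_self[OF carr[OF rep(1)[OF x]]] rep(2)[OF x] by simp
    then obtain u v where uv: "u \<in> U_int m" "v \<in> U_int m" and r: "?r = u * g * v"
      by (auto simp: double_coset_def)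
    \<comment> \<open>Two representatives differ by integral factors, and \<open>\<alpha>\<close>
      and \<open>\<beta>\<close> keep these integral.\<close>
    have "\<iota> ?r = \<alpha> u * \<iota> g * \<beta> v"
      unfolding r using uv carr[OF g] by (intro iota_mult U_int_U_real)
    then show ?thesis
      unfolding \<Phi>_def using uv g by (simp add: double_coset_mult iota_carrier carr alpha_int beta_int)
  qed
  have "bij_betw \<Phi> ?X' ?X"
  proof (rule bij_betw_imageI)
    show "inj_on \<Phi> ?X'"
      using iota_double_coset_subset carr \<Phi>
      by (auto simp: X_cosets_def inj_on_def) (metis subsetD)+
    show "\<Phi> ` ?X' = ?X"
    proof (intro equalityI subsetI)
      fix y assume "y \<in> \<Phi> ` ?X'"
      then obtain g where g: "g \<in> bruhat_cell m (mat_diag m f')" and y: "y = double_coset n (\<iota> g)"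
        using \<Phi> by (auto simp: X_cosets_def)
      from g obtain a1 a2 where a: "a1 \<in> U_real m" "a2 \<in> U_real m"
        "g = a1 * (mat_diag m f' * w_long m) * a2" "g \<in> SL_int m" by (rule bruhat_cellE)
      have "\<iota> g \<in> SL_int n" using a(4) iota_SL[OF carr[OF g]] by simp
      then have "\<iota> g \<in> bruhat_cell n (mat_diag n f)"
        unfolding a(3) iota_bruhat[OF a(1,2)] using a by (intro bruhat_cellI alpha_real beta_real)
      then show "y \<in> ?X" using y by (auto simp: X_cosets_def)
    next
      fix y assume "y \<in> ?X"
      then obtain g where g: "g \<in> bruhat_cell n (mat_diag n f)" and y: "y = double_coset n g"
        by (auto simp: X_cosets_def)
      from g obtain b1 b2 where b: "b1 \<in> U_real n" "b2 \<in> U_real n"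
        "g = b1 * (mat_diag n f * w_long n) * b2" "g \<in> SL_int n" by (rule bruhat_cellE)
      \<comment> \<open>Surjectivity: after the integral factors \<open>P\<close> and
        \<open>Q\<close> are split off, what remains of \<open>g\<close> is the image of
        \<open>h\<close>, built from \<open>a1\<close> and \<open>a2\<close>.\<close>
      obtain P Q a1 a2 where PQ: "P \<in> U_int n" "Q \<in> U_int n" and a: "a1 \<in> U_real m" "a2 \<in> U_real m"
        and ba: "b1 = P * \<alpha> a1" "b2 = \<beta> a2 * Q"
        using factor[of b1 b2] b by blast
      define h where "h = a1 * (mat_diag m f' * w_long m) * a2"
      have h: "h \<in> carrier_mat m m"
        unfolding h_def using a[THEN U_real_carrier] mat_diag_w_long_carrier[of m f'] by auto
      note PQr = PQ[THEN U_int_U_real]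
      note carr = PQr[THEN U_real_carrier] mat_diag_w_long_carrier[of n f]
        a(1)[THEN alpha_real, THEN U_real_carrier] a(2)[THEN beta_real, THEN U_real_carrier]
      have gh: "g = P * \<iota> h * Q"
        unfolding b(3) ba h_def iota_bruhat[OF a] using carr
        by (simp add: assoc_mult_mat[of _ n n _ n _ n] del: assoc_mult_mat)
      \<comment> \<open>Cancelling \<open>P\<close> and \<open>Q\<close> by integral inverses of
        determinant 1 keeps \<open>g\<close> integral of determinant 1; \<open>iota_SL\<close> then
        brings this down to \<open>h\<close>.\<close>
      have "\<iota> h \<in> SL_int n"
      proof -
        obtain P' where P': "P' \<in> U_int n" "P' * P = 1\<^sub>m n" by (rule U_int_inverse[OF PQ(1)])
        obtain Q' where Q': "Q' \<in> U_int n" "Q * Q' = 1\<^sub>m n" by (rule U_int_inverse[OF PQ(2)])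
        note carr' = P'(1)[THEN U_int_U_real, THEN U_real_carrier] Q'(1)[THEN U_int_U_real, THEN U_real_carrier]
          PQr[THEN U_real_carrier] iota_carrier[OF h]
        have "P' * g * Q' = (P' * P) * \<iota> h * (Q * Q')"
          unfolding gh using carr' by (simp add: assoc_mult_mat[of _ n n _ n _ n])
        then have eq: "P' * g * Q' = \<iota> h" using P' Q' carr' by simp
        have gc: "g \<in> carrier_mat n n" "elements_mat g \<subseteq> \<int>" "det g = 1"
          using b(4) by (auto simp: SL_int_def)
        have "elements_mat (P' * g * Q') \<subseteq> \<int>"
          using P'(1) Q'(1) gc carr' by (intro elements_mat_mult_Ints[of _ n n _ n]) (auto simp: U_int_def)
        moreover have "det (P' * g * Q') = 1"
          using P'(1) Q'(1) gc carr' by (simp add: det_mult[of _ n] det_U_real[OF U_int_U_real])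
        ultimately show ?thesis
          using iota_carrier[OF h] unfolding eq SL_int_def by blast
      qed
      then have "h \<in> bruhat_cell m (mat_diag m f')"
        using a h iota_SL unfolding h_def by (intro bruhat_cellI) auto
      moreover from this have "\<Phi> (double_coset m h) = y"
        by (simp add: \<Phi> y gh double_coset_mult PQ iota_carrier h)
      ultimately show "y \<in> \<Phi> ` ?X'" by (auto simp: X_cosets_def)
    qed
  qed
  moreover have "summand n R N (mat_diag n f) (\<Phi> x) = summand m R' N' (mat_diag m f') x" if x: "x \<in> ?X'" for x
  proof -
    obtain g where g: "g \<in> bruhat_cell m (mat_diag m f')" and xg: "x = double_coset m g"
      using x by (auto simp: X_cosets_def)
    from g obtain a1 a2 where a: "a1 \<in> U_real m" "a2 \<in> U_real m"
      "g = a1 * (mat_diag m f' * w_long m) * a2" "g \<in> SL_int m" by (rule bruhat_cellE)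
    show ?thesis
      unfolding xg \<Phi>[OF g] unfolding a(3) iota_bruhat[OF a(1,2)]
      using a nonzero by (simp add: summand_double_coset alpha_real beta_real psi_alpha psi_beta)
  qed
  ultimately show ?thesis
    by (subst sum.reindex_bij_betw[symmetric]) (auto intro: sum.cong)
qed

end

subsection \<open>The two bordering maps\<close>

text \<open>
  The signs make both maps preserve the determinant and send \<open>w_long m\<close> to \<open>w_long (Suc m)\<close>.
\<close>

definition lower_corner :: "nat \<Rightarrow> real mat \<Rightarrow> real mat" where
  "lower_corner m g = four_block_mat (0\<^sub>m m 1) (- g) (1\<^sub>m 1) (0\<^sub>m 1 m)"

definition upper_corner :: "nat \<Rightarrow> real mat \<Rightarrow> real mat" where
  "upper_corner m g = four_block_mat (0\<^sub>m 1 m) ((- 1) ^ m \<cdot>\<^sub>m 1\<^sub>m 1) g (0\<^sub>m m 1)"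

lemma lower_corner_carrier: "g \<in> carrier_mat m m \<Longrightarrow> lower_corner m g \<in> carrier_mat (Suc m) (Suc m)"
  by (auto simp: lower_corner_def)

lemma upper_corner_carrier: "g \<in> carrier_mat m m \<Longrightarrow> upper_corner m g \<in> carrier_mat (Suc m) (Suc m)"
  by (auto simp: upper_corner_def)

text \<open>Here \<open>p\<close> and \<open>q\<close> appear unchanged as blocks of the product, so
  that their integrality or vanishing can be read off directly.\<close>

lemma back_lower_corner_front:
  assumes h: "h \<in> carrier_mat m m" and b: "b \<in> carrier_mat m m" "p \<in> carrier_mat m 1"
    and a: "a \<in> carrier_mat m m" "q \<in> carrier_mat 1 m"
  shows "back_block m b p * lower_corner m h * front_block m q a =
    four_block_mat p (p * q + - (b * h * a)) (1\<^sub>m 1) q"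
proof -
  have bh: "b * (- h) = - (b * h)" using h b by simp
  have c: "b * h \<in> carrier_mat m m" "- (b * h) \<in> carrier_mat m m" using h b by auto
  have "back_block m b p * lower_corner m h = four_block_mat p (- (b * h)) (1\<^sub>m 1) (0\<^sub>m 1 m)"
    unfolding back_block_def lower_corner_def using h b c
    by (subst mult_four_block_mat[of _ m m _ 1 _ 1 _ _ 1 _ m]) (auto simp: bh simp del: One_nat_def)
  then show ?thesis
    unfolding front_block_def using h b a c
    by simp (subst mult_four_block_mat[of _ m 1 _ m _ 1 _ _ 1 _ m]; auto simp del: One_nat_def)
qed

text \<open>Here \<open>p\<close> and \<open>q\<close> appear only multiplied by \<open>h\<close>
  and a unipotent factor. Recovering them takes the inverse of the lower left block
  \<open>b * h * a\<close>.\<close>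

lemma front_upper_corner_back:
  assumes h: "h \<in> carrier_mat m m" and b: "b \<in> carrier_mat m m" "p \<in> carrier_mat 1 m"
    and a: "a \<in> carrier_mat m m" "q \<in> carrier_mat m 1"
  shows "front_block m p b * upper_corner m h * back_block m a q =
    four_block_mat (p * h * a) (p * h * q + (- 1) ^ m \<cdot>\<^sub>m 1\<^sub>m 1) (b * h * a) (b * h * q)"
proof -
  have c: "p * h \<in> carrier_mat 1 m" "b * h \<in> carrier_mat m m" using h b by auto
  have "front_block m p b * upper_corner m h =
      four_block_mat (p * h) ((- 1) ^ m \<cdot>\<^sub>m 1\<^sub>m 1) (b * h) (0\<^sub>m m 1)"
    unfolding front_block_def upper_corner_def using h b c
    by (subst mult_four_block_mat[of _ 1 1 _ m _ m _ _ m _ 1]) (auto simp del: One_nat_def)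
  then show ?thesis
    unfolding back_block_def using h b a c
    by simp (subst mult_four_block_mat[of _ 1 m _ 1 _ m _ _ m _ 1]; auto simp del: One_nat_def)
qed

lemma det_lower_corner:
  assumes g: "g \<in> carrier_mat m m"
  shows "det (lower_corner m g) = det g"
proof -
  \<comment> \<open>Transposing moves the zero column to the lower right, as the block determinant
    formula requires. Its sign \<open>(- 1) ^ m\<close> cancels the one coming from the negated
    block.\<close>
  have "(lower_corner m g)\<^sup>T = four_block_mat (0\<^sub>m 1 m) (1\<^sub>m 1) (- g\<^sup>T) (0\<^sub>m m 1)"
    using g by (intro eq_matI) (auto simp: lower_corner_def)
  then have "det (lower_corner m g) = (- 1) ^ m * det (- g\<^sup>T)"
    using g det_transpose[OF lower_corner_carrier[OF g]]
    by (simp add: det_four_block_mat_lower_right_zero_col[of _ m])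
  also have "- g\<^sup>T = (- 1) \<cdot>\<^sub>m g\<^sup>T" by (intro eq_matI) auto
  also have "(- 1) ^ m * det ((- 1) \<cdot>\<^sub>m g\<^sup>T) = det g"
    using g by (simp add: det_smult det_transpose flip: power_mult_distrib)
  finally show ?thesis .
qed

lemma det_upper_corner:
  assumes g: "g \<in> carrier_mat m m"
  shows "det (upper_corner m g) = det g"
  using g unfolding upper_corner_def
  by (subst det_four_block_mat_lower_right_zero_col[of _ m])
    (auto simp flip: power_mult_distrib)

lemma lower_corner_SL_int:
  assumes g: "g \<in> carrier_mat m m"
  shows "lower_corner m g \<in> SL_int (Suc m) \<longleftrightarrow> g \<in> SL_int m"
proof -
  have "elements_mat (lower_corner m g) \<subseteq> \<int> \<longleftrightarrow> elements_mat (- g) \<subseteq> \<int>"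
    unfolding lower_corner_def using g
    by (subst elements_four_block_mat_subset_iff[of _ m 1 _ m _ 1])
      (simp_all add: elements_one_mat_Ints elements_zero_mat_Ints del: One_nat_def)
  moreover have "elements_mat (- g) \<subseteq> \<int> \<longleftrightarrow> elements_mat g \<subseteq> \<int>"
    using g by (simp add: elements_mat_subset_iff)
  ultimately show ?thesis
    using g by (simp add: SL_int_def lower_corner_carrier det_lower_corner)
qed

lemma upper_corner_SL_int:
  assumes g: "g \<in> carrier_mat m m"
  shows "upper_corner m g \<in> SL_int (Suc m) \<longleftrightarrow> g \<in> SL_int m"
proof -
  have "elements_mat ((- 1) ^ m \<cdot>\<^sub>m 1\<^sub>m 1 :: real mat) \<subseteq> \<int>"
    by (subst elements_mat_subset_iff[of _ 1 1]) auto
  then have "elements_mat (upper_corner m g) \<subseteq> \<int> \<longleftrightarrow> elements_mat g \<subseteq> \<int>"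
    unfolding upper_corner_def using g
    by (subst elements_four_block_mat_subset_iff[of _ 1 m _ 1 _ m])
      (simp_all add: elements_one_mat_Ints elements_zero_mat_Ints del: One_nat_def)
  then show ?thesis
    using g by (simp add: SL_int_def upper_corner_carrier det_upper_corner)
qed

text \<open>The old block moves one column to the right, which flips the alternating sign of
  \<open>w_long\<close>; the minus sign in \<open>lower_corner\<close> compensates. The new entry is
  in column 0 and has sign 1.\<close>

lemma lower_corner_long:
  assumes "\<And>i. i < m \<Longrightarrow> f i = f' i" "f m = 1"
  shows "lower_corner m (mat_diag m f' * w_long m) = mat_diag (Suc m) f * w_long (Suc m)"
proof (rule eq_matI)
  fix i j assume "i < dim_row (mat_diag (Suc m) f * w_long (Suc m))"
    "j < dim_col (mat_diag (Suc m) f * w_long (Suc m))"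
  then have ij: "i < Suc m" "j < Suc m"
    using mat_diag_w_long_carrier[of "Suc m" f] by (metis carrier_matD)+
  note T = mat_diag_w_long_carrier[of m f']
  have "lower_corner m (mat_diag m f' * w_long m) $$ (i, j) =
      (if i < m then if j = 0 then 0 else - (mat_diag m f' * w_long m) $$ (i, j - 1)
       else if j = 0 then 1 else 0)"
    using ij carrier_matD[OF T] unfolding lower_corner_def
    by (auto simp del: index_mult_mat(1))
  also have "\<dots> = (mat_diag (Suc m) f * w_long (Suc m)) $$ (i, j)"
    using ij assms by (cases j) (auto simp: mat_diag_w_long_index simp del: index_mult_mat(1))
  finally show "lower_corner m (mat_diag m f' * w_long m) $$ (i, j) =
    (mat_diag (Suc m) f * w_long (Suc m)) $$ (i, j)" .
qed (use carrier_matD[OF lower_corner_carrier[OF mat_diag_w_long_carrier[of m f']]]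
      carrier_matD[OF mat_diag_w_long_carrier[of "Suc m" f]] in simp_all)

text \<open>The old block moves down by one row and keeps its columns, hence its signs. The new
  entry is in column \<open>m\<close>, which accounts for \<open>(- 1) ^ m\<close>.\<close>

lemma upper_corner_long:
  assumes "\<And>i. i < m \<Longrightarrow> f (Suc i) = f' i" "f 0 = 1"
  shows "upper_corner m (mat_diag m f' * w_long m) = mat_diag (Suc m) f * w_long (Suc m)"
proof (rule eq_matI)
  fix i j assume "i < dim_row (mat_diag (Suc m) f * w_long (Suc m))"
    "j < dim_col (mat_diag (Suc m) f * w_long (Suc m))"
  then have ij: "i < Suc m" "j < Suc m"
    using mat_diag_w_long_carrier[of "Suc m" f] by (metis carrier_matD)+
  note T = mat_diag_w_long_carrier[of m f']
  have "upper_corner m (mat_diag m f' * w_long m) $$ (i, j) =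
      (if i = 0 then if j = m then (- 1) ^ m else 0
       else if j = m then 0 else (mat_diag m f' * w_long m) $$ (i - 1, j))"
    using ij carrier_matD[OF T] unfolding upper_corner_def
    by (auto simp del: index_mult_mat(1))
  also have "\<dots> = (mat_diag (Suc m) f * w_long (Suc m)) $$ (i, j)"
    using ij assms by (cases i) (auto simp: mat_diag_w_long_index simp del: index_mult_mat(1))
  finally show "upper_corner m (mat_diag m f' * w_long m) $$ (i, j) =
    (mat_diag (Suc m) f * w_long (Suc m)) $$ (i, j)" .
qed (use carrier_matD[OF upper_corner_carrier[OF mat_diag_w_long_carrier[of m f']]]
      carrier_matD[OF mat_diag_w_long_carrier[of "Suc m" f]] in simp_all)

text \<open>The new superdiagonal entry is the one for \<open>k = 1\<close> and is 0; the others
  move up by one index, so the first entry of \<open>L\<close> drops out. For \<open>m = 0\<close>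
  both sums are empty.\<close>

lemma psi_front_block:
  assumes "u \<in> carrier_mat m m" "length L = m"
  shows "psi (Suc m) L (front_block m (0\<^sub>m 1 m) u) = psi m (drop 1 L) u"
proof (cases m)
  case (Suc l)
  have "(\<Sum>k = 1..m. of_int (entry L k) * front_block m (0\<^sub>m 1 m) u $$ (k - 1, k)) =
      (\<Sum>k\<in>Suc ` {1..l}. of_int (entry L k) * front_block m (0\<^sub>m 1 m) u $$ (k - 1, k))"
  proof (rule sum.mono_neutral_right)
    have "k = 1" if "k \<in> {1..m} - Suc ` {1..l}" for k
      using that Suc by (cases k) (auto simp: image_iff Suc_le_eq)
    then show "\<forall>k\<in>{1..m} - Suc ` {1..l}. of_int (entry L k) * front_block m (0\<^sub>m 1 m) u $$ (k - 1, k) = 0"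
      using assms Suc by (auto simp: front_block_def)
  qed (use Suc in auto)
  also have "\<dots> = (\<Sum>k = 1..l. of_int (entry (drop 1 L) k) * u $$ (k - 1, k))"
    using assms Suc by (subst sum.reindex) (auto simp: front_block_def entry_def intro!: sum.cong)
  finally show ?thesis using Suc by (simp add: psi_def)
qed (simp add: psi_def)

text \<open>The new superdiagonal entry is the one for \<open>k = m\<close> and is 0, while the
  others stay in place, so the last entry of \<open>L\<close> drops out.\<close>

lemma psi_back_block:
  assumes "u \<in> carrier_mat m m" "length L = m"
  shows "psi (Suc m) L (back_block m u (0\<^sub>m m 1)) = psi m (take (m - 1) L) u"
proof -
  have "(\<Sum>k = 1..m. of_int (entry L k) * back_block m u (0\<^sub>m m 1) $$ (k - 1, k)) =
      (\<Sum>k = 1..m - 1. of_int (entry L k) * back_block m u (0\<^sub>m m 1) $$ (k - 1, k))"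
  proof (rule sum.mono_neutral_right)
    have "k = m \<and> 1 \<le> m" if "k \<in> {1..m} - {1..m - 1}" for k
      using that by auto
    then show "\<forall>k\<in>{1..m} - {1..m - 1}. of_int (entry L k) * back_block m u (0\<^sub>m m 1) $$ (k - 1, k) = 0"
      using assms by (fastforce simp: back_block_def)
  qed auto
  also have "\<dots> = (\<Sum>k = 1..m - 1. of_int (entry (take (m - 1) L) k) * u $$ (k - 1, k))"
    using assms by (intro sum.cong) (auto simp: back_block_def entry_def)
  finally show ?thesis by (simp add: psi_def)
qed

text \<open>The case of a first entry 1: for the coefficients of \<open>c_diag\<close>,
  \<open>f m\<close> is the first entry of the tuple. When \<open>R\<close> is \<open>rev M\<close>,
  losing its last entry means that \<open>M\<close> loses its first one, as does
  \<open>N\<close>.\<close>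

lemma lower_corner_embedding:
  assumes f: "\<forall>i<m. f i \<noteq> 0" "\<And>i. i < m \<Longrightarrow> f i = f' i" "f m = 1"
    and len: "length R = m" "length N = m"
  shows "kloosterman_embedding (Suc m) m f f' (lower_corner m)
    (\<lambda>u. back_block m u (0\<^sub>m m 1)) (front_block m (0\<^sub>m 1 m)) R N (take (m - 1) R) (drop 1 N)"
proof
  show "\<forall>i<Suc m. f i \<noteq> 0" "\<forall>i<m. f' i \<noteq> 0"
    using f by (auto simp: less_Suc_eq)
next
  fix u v g :: "real mat" assume u: "u \<in> U_real m" "v \<in> U_real m" and g: "g \<in> carrier_mat m m"
  then show "lower_corner m (u * g * v) =
      back_block m u (0\<^sub>m m 1) * lower_corner m g * front_block m (0\<^sub>m 1 m) v"
    using u[THEN U_real_carrier] by (subst back_lower_corner_front) (auto simp: lower_corner_def)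
next
  show "lower_corner m (mat_diag m f' * w_long m) = mat_diag (Suc m) f * w_long (Suc m)"
    using f by (intro lower_corner_long) auto
next
  fix u v g h :: "real mat" assume u: "u \<in> U_int (Suc m)" and v: "v \<in> U_int (Suc m)"
    and g: "g \<in> carrier_mat m m" and h: "h \<in> carrier_mat m m"
    and eq: "lower_corner m g = u * lower_corner m h * v"
  obtain b p where b: "u = back_block m b p" "p \<in> carrier_mat m 1" "b \<in> U_real m"
    using U_real_back_blockE[OF U_int_U_real[OF u]] .
  obtain q a where a: "v = front_block m q a" "q \<in> carrier_mat 1 m" "a \<in> U_real m"
    using U_real_front_blockE[OF U_int_U_real[OF v]] .
  note carr = b(3)[THEN U_real_carrier] a(3)[THEN U_real_carrier]
  have ba: "b \<in> U_int m" "a \<in> U_int m"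
    using u v a b carr elements_back_block[of p m b] elements_front_block[of q m a] by (auto simp: U_int_def)
  \<comment> \<open>Comparing first columns and last rows forces \<open>p\<close> and
    \<open>q\<close> to vanish; the upper right blocks then give
    \<open>g = b * h * a\<close>.\<close>
  have "four_block_mat (0\<^sub>m m 1) (- g) (1\<^sub>m 1) (0\<^sub>m 1 m) =
      four_block_mat p (p * q + - (b * h * a)) (1\<^sub>m 1) q"
    using eq a b carr h by (simp add: back_lower_corner_front) (simp add: lower_corner_def)
  then have "0\<^sub>m m 1 = p \<and> - g = p * q + - (b * h * a) \<and> 1\<^sub>m 1 = (1\<^sub>m 1 :: real mat) \<and> 0\<^sub>m 1 m = q"
    using a b carr h g
    by (subst (asm) four_block_mat_eq_iff[of _ m 1 _ m _ 1]) (simp_all del: One_nat_def)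
  then have pq: "p = 0\<^sub>m m 1" "q = 0\<^sub>m 1 m" "- g = p * q + - (b * h * a)" by auto
  have bha: "b * h * a \<in> carrier_mat m m" using carr h by auto
  have "- g = - (b * h * a)" using pq(3) bha by (simp add: pq(1,2))
  then have "g = b * h * a"
    by (metis uminus_uminus_mat)
  then show "g \<in> double_coset m h" using ba by (simp add: double_cosetI)
next
  fix b1 b2 :: "real mat" assume b1: "b1 \<in> U_real (Suc m)" and b2: "b2 \<in> U_real (Suc m)"
    and SL: "b1 * (mat_diag (Suc m) f * w_long (Suc m)) * b2 \<in> SL_int (Suc m)"
  obtain b p where b: "b1 = back_block m b p" "p \<in> carrier_mat m 1" "b \<in> U_real m"
    using U_real_back_blockE[OF b1] .
  obtain q a where a: "b2 = front_block m q a" "q \<in> carrier_mat 1 m" "a \<in> U_real m"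
    using U_real_front_blockE[OF b2] .
  let ?T = "mat_diag m f' * w_long m"
  note carr = b(3)[THEN U_real_carrier] a(3)[THEN U_real_carrier] mat_diag_w_long_carrier[of m f']
  have "lower_corner m ?T = mat_diag (Suc m) f * w_long (Suc m)"
    using f by (intro lower_corner_long) auto
  then have "four_block_mat p (p * q + - (b * ?T * a)) (1\<^sub>m 1) q \<in> SL_int (Suc m)"
    using SL back_lower_corner_front[OF carr(3,1) b(2) carr(2) a(2)] by (simp add: a(1) b(1))
  then have "elements_mat (four_block_mat p (p * q + - (b * ?T * a)) (1\<^sub>m 1) q) \<subseteq> \<int>"
    by (simp add: SL_int_def)
  moreover have "p * q + - (b * ?T * a) \<in> carrier_mat m m"
    using mult_carrier_mat[OF mult_carrier_mat[OF carr(1,3)] carr(2)]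
    by (intro add_carrier_mat uminus_carrier_mat)
  ultimately have int: "elements_mat p \<subseteq> \<int>" "elements_mat q \<subseteq> \<int>"
    using a b by (auto simp only: elements_four_block_mat_subset_iff[of p m 1 _ m _ 1] one_carrier_mat)
  \<comment> \<open>Since \<open>p\<close> and \<open>q\<close> are integral, they split off as
    outer integral factors.\<close>
  have "b1 = back_block m (1\<^sub>m m) p * back_block m b (0\<^sub>m m 1)"
    using b carr by (subst back_block_mult) (auto simp del: One_nat_def)
  moreover have "b2 = front_block m (0\<^sub>m 1 m) a * front_block m q (1\<^sub>m m)"
    using a carr by (subst front_block_mult) (auto simp del: One_nat_def)
  moreover have "back_block m (1\<^sub>m m) p \<in> U_int (Suc m)" "front_block m q (1\<^sub>m m) \<in> U_int (Suc m)"
    using int a b by (auto intro: back_block_U_int front_block_U_int one_mat_U_int)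
  ultimately show "\<exists>P\<in>U_int (Suc m). \<exists>Q\<in>U_int (Suc m). \<exists>a1\<in>U_real m. \<exists>a2\<in>U_real m.
      b1 = P * back_block m a1 (0\<^sub>m m 1) \<and> b2 = front_block m (0\<^sub>m 1 m) a2 * Q"
    using a(3) b(3) by blast
qed (auto simp: lower_corner_carrier lower_corner_SL_int psi_front_block psi_back_block U_real_carrier
    elements_zero_mat_Ints len simp del: One_nat_def
    intro!: back_block_U_real front_block_U_real back_block_U_int front_block_U_int
      elements_zero_mat_Ints[THEN subsetD])

text \<open>The case of a last entry 1: for the coefficients of \<open>c_diag\<close>,
  \<open>f 0\<close> is the reciprocal of the last entry. The blocks for left and right factors
  change roles, so \<open>R\<close> loses its first entry and \<open>N\<close> its last.\<close>

lemma upper_corner_embedding: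
  assumes f: "\<forall>i<m. f' i \<noteq> 0" "\<And>i. i < m \<Longrightarrow> f (Suc i) = f' i" "f 0 = 1"
    and len: "length R = m" "length N = m"
  shows "kloosterman_embedding (Suc m) m f f' (upper_corner m)
    (front_block m (0\<^sub>m 1 m)) (\<lambda>u. back_block m u (0\<^sub>m m 1)) R N (drop 1 R) (take (m - 1) N)"
proof
  show "\<forall>i<Suc m. f i \<noteq> 0" "\<forall>i<m. f' i \<noteq> 0"
    using f by (auto simp: less_Suc_eq_0_disj)
next
  fix u v g :: "real mat" assume u: "u \<in> U_real m" "v \<in> U_real m" and g: "g \<in> carrier_mat m m"
  then show "upper_corner m (u * g * v) =
      front_block m (0\<^sub>m 1 m) u * upper_corner m g * back_block m v (0\<^sub>m m 1)"
    using u[THEN U_real_carrier]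
    by (subst front_upper_corner_back) (auto simp: upper_corner_def simp del: One_nat_def)
next
  show "upper_corner m (mat_diag m f' * w_long m) = mat_diag (Suc m) f * w_long (Suc m)"
    using f by (intro upper_corner_long) auto
next
  fix u v g h :: "real mat" assume u: "u \<in> U_int (Suc m)" and v: "v \<in> U_int (Suc m)"
    and g: "g \<in> carrier_mat m m" and h: "h \<in> carrier_mat m m"
    and eq: "upper_corner m g = u * upper_corner m h * v"
  obtain p b where b: "u = front_block m p b" "p \<in> carrier_mat 1 m" "b \<in> U_real m"
    using U_real_front_blockE[OF U_int_U_real[OF u]] .
  obtain a q where a: "v = back_block m a q" "q \<in> carrier_mat m 1" "a \<in> U_real m"
    using U_real_back_blockE[OF U_int_U_real[OF v]] .
  note carr = b(3)[THEN U_real_carrier] a(3)[THEN U_real_carrier]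
  have ba: "b \<in> U_int m" "a \<in> U_int m"
    using u v a b carr elements_back_block[of q m a] elements_front_block[of p m b] by (auto simp: U_int_def)
  have c: "p * h * a \<in> carrier_mat 1 m" "p * h * q + (- 1) ^ m \<cdot>\<^sub>m 1\<^sub>m 1 \<in> carrier_mat 1 1"
    "b * h * a \<in> carrier_mat m m" "b * h * q \<in> carrier_mat m 1"
    using a b carr h by auto
  have "upper_corner m g =
      four_block_mat (p * h * a) (p * h * q + (- 1) ^ m \<cdot>\<^sub>m 1\<^sub>m 1) (b * h * a) (b * h * q)"
    unfolding eq a(1) b(1) by (rule front_upper_corner_back[OF h carr(1) b(2) carr(2) a(2)])
  then have "g = b * h * a"
    using c g unfolding upper_corner_def
    by (subst (asm) four_block_mat_eq_iff[of _ 1 m _ 1 _ m]) (simp_all del: One_nat_def)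
  then show "g \<in> double_coset m h" using ba by (simp add: double_cosetI)
next
  fix b1 b2 :: "real mat" assume b1: "b1 \<in> U_real (Suc m)" and b2: "b2 \<in> U_real (Suc m)"
    and SL: "b1 * (mat_diag (Suc m) f * w_long (Suc m)) * b2 \<in> SL_int (Suc m)"
  obtain p b where b: "b1 = front_block m p b" "p \<in> carrier_mat 1 m" "b \<in> U_real m"
    using U_real_front_blockE[OF b1] .
  obtain a q where a: "b2 = back_block m a q" "q \<in> carrier_mat m 1" "a \<in> U_real m"
    using U_real_back_blockE[OF b2] .
  let ?T = "mat_diag m f' * w_long m"
  obtain b' where b': "b' \<in> U_real m" "b * b' = 1\<^sub>m m" "b' * b = 1\<^sub>m m"
    by (rule U_real_inverse[OF b(3)])
  obtain a' where a': "a' \<in> U_real m" "a * a' = 1\<^sub>m m" "a' * a = 1\<^sub>m m"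
    by (rule U_real_inverse[OF a(3)])
  note carr = b(3)[THEN U_real_carrier] a(3)[THEN U_real_carrier] mat_diag_w_long_carrier[of m f']
    b'(1)[THEN U_real_carrier] a'(1)[THEN U_real_carrier] a(2) b(2)
  define E where "E = ((- 1) ^ m \<cdot>\<^sub>m 1\<^sub>m 1 :: real mat)"
  have E: "E \<in> carrier_mat 1 1" by (simp add: E_def)
  have T: "upper_corner m ?T = mat_diag (Suc m) f * w_long (Suc m)"
    using f by (intro upper_corner_long) auto
  define G where "G = b * ?T * a"
  have G: "G \<in> carrier_mat m m" using carr by (auto simp: G_def)
  have c: "p * ?T * a \<in> carrier_mat 1 m" "p * ?T * q + E \<in> carrier_mat 1 1" "b * ?T * q \<in> carrier_mat m 1"
    using carr E by auto
  have SL': "four_block_mat (p * ?T * a) (p * ?T * q + E) G (b * ?T * q) \<in> SL_int (Suc m)"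
    using SL unfolding a(1) b(1) T[symmetric] E_def G_def
    by (subst (asm) front_upper_corner_back) (use carr in auto)
  then have "elements_mat (four_block_mat (p * ?T * a) (p * ?T * q + E) G (b * ?T * q)) \<subseteq> \<int>"
    by (simp add: SL_int_def)
  then have int: "elements_mat (p * ?T * a) \<subseteq> \<int>" "elements_mat G \<subseteq> \<int>" "elements_mat (b * ?T * q) \<subseteq> \<int>"
    unfolding elements_four_block_mat_subset_iff[OF c(1,2) G c(3)] by auto
  \<comment> \<open>Unipotent factors have determinant 1 and bordering preserves the determinant.
    Hence the integral block \<open>G\<close> has determinant 1, and its inverse \<open>H\<close> is
    integral.\<close>
  have "det (b1 * upper_corner m ?T * b2) = det (upper_corner m ?T)"
    using U_real_carrier[OF b1] U_real_carrier[OF b2] upper_corner_carrier[OF carr(3)] b1 b2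
    by (simp add: det_mult[of _ "Suc m"] det_U_real)
  then have "det ?T = 1"
    using SL carr by (simp add: T[symmetric] SL_int_def det_upper_corner)
  then have "det G = 1"
    using carr a b by (simp add: G_def det_mult[of _ m] det_U_real)
  then have "G \<in> SL_int m" using G int by (simp add: SL_int_def)
  then obtain H where H: "H \<in> carrier_mat m m" "elements_mat H \<subseteq> \<int>" "G * H = 1\<^sub>m m" "H * G = 1\<^sub>m m"
    by (rule SL_int_inverse)
  \<comment> \<open>The rows and columns to be split off are \<open>p * b'\<close> and
    \<open>a' * q\<close>. They are integral because they equal \<open>(p * ?T * a) * H\<close> and
    \<open>H * (b * ?T * q)\<close>, products of integral matrices.\<close>
  have pb: "p * b' \<in> carrier_mat 1 m" and aq: "a' * q \<in> carrier_mat m 1" using carr by auto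
  have "?T * (a * H) \<in> carrier_mat m m"
    by (rule mult_carrier_mat[OF carr(3) mult_carrier_mat[OF carr(2) H(1)]])
  note one_TaH = left_mult_one_mat[OF this]
  have "p * b' = p * b' * (G * H)" by (simp only: H(3) right_mult_one_mat[OF pb])
  also have "\<dots> = p * ((b' * b) * (?T * (a * H)))"
    using carr H(1) by (simp add: G_def assoc_mult_mat[of _ 1 m _ m _ m] assoc_mult_mat[of _ m m _ m _ m] del: One_nat_def)
  also have "\<dots> = p * ?T * a * H"
    using carr H b' by (simp add: one_TaH assoc_mult_mat[of _ 1 m _ m _ m] assoc_mult_mat[of _ m m _ m _ m] del: One_nat_def)
  finally have pb_int: "elements_mat (p * b') \<subseteq> \<int>"
    using elements_mat_mult_Ints[OF c(1) H(1) int(1) H(2)] by simp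
  have "a' * q = (H * G) * (a' * q)" by (simp only: H(4) left_mult_one_mat[OF aq])
  also have "\<dots> = H * (b * (?T * ((a * a') * q)))"
    using carr H(1) by (simp add: G_def assoc_mult_mat[of _ m m _ m _ 1] assoc_mult_mat[of _ m m _ m _ m] del: One_nat_def)
  also have "\<dots> = H * (b * ?T * q)"
    using carr H a' by (simp add: assoc_mult_mat[of _ m m _ m _ 1] assoc_mult_mat[of _ m m _ m _ m] del: One_nat_def)
  finally have aq_int: "elements_mat (a' * q) \<subseteq> \<int>"
    using elements_mat_mult_Ints[OF H(1) c(3) H(2) int(3)] by simp
  have "p * b' * b = p"
    using carr b' by (simp add: assoc_mult_mat[of _ 1 m _ m _ m] del: One_nat_def)
  \<comment> \<open>The integral factor stands outside, next to the block \<open>b\<close>, which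
    multiplies its row: \<open>p * b'\<close> becomes \<open>p\<close>. For \<open>b2\<close>
    likewise \<open>a\<close> turns \<open>a' * q\<close> into \<open>q\<close>.\<close>
  then have "b1 = front_block m (p * b') (1\<^sub>m m) * front_block m (0\<^sub>m 1 m) b"
    using b carr pb by (subst front_block_mult) (auto simp del: One_nat_def)
  moreover have "a * (a' * q) = q"
    using carr a' by (simp add: assoc_mult_mat[of _ m m _ m _ 1, symmetric] del: One_nat_def)
  then have "b2 = back_block m a (0\<^sub>m m 1) * back_block m (1\<^sub>m m) (a' * q)"
    using a carr aq by (subst back_block_mult) (auto simp del: One_nat_def)
  moreover have "front_block m (p * b') (1\<^sub>m m) \<in> U_int (Suc m)" "back_block m (1\<^sub>m m) (a' * q) \<in> U_int (Suc m)"
    using pb_int aq_int pb aq by (auto intro: back_block_U_int front_block_U_int one_mat_U_int)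
  ultimately show "\<exists>P\<in>U_int (Suc m). \<exists>Q\<in>U_int (Suc m). \<exists>a1\<in>U_real m. \<exists>a2\<in>U_real m.
      b1 = P * front_block m (0\<^sub>m 1 m) a1 \<and> b2 = back_block m a2 (0\<^sub>m m 1) * Q"
    using a(3) b(3) by blast
qed (auto simp: upper_corner_carrier upper_corner_SL_int psi_front_block psi_back_block U_real_carrier
    elements_zero_mat_Ints len simp del: One_nat_def
    intro!: back_block_U_real front_block_U_real back_block_U_int front_block_U_int
      elements_zero_mat_Ints[THEN subsetD])

subsection \<open>Removing entries equal to 1\<close>

text \<open>The local function \<open>d\<close> of \<open>c_diag\<close>, made global so that its
  values for a tuple and for a shortened one can be compared.\<close>

definition c_coeff :: "nat \<Rightarrow> int list \<Rightarrow> nat \<Rightarrow> real" where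
  "c_coeff n D k = (if k = 0 \<or> k = n then 1 else real_of_int (entry D k))"

lemma c_diag_coeff: "c_diag n D = mat_diag n (\<lambda>i. c_coeff n D (n - i) / c_coeff n D (n - i - 1))"
  by (simp add: c_diag_def c_coeff_def Let_def)

lemma kloosterman_drop_1:
  assumes m: "1 \<le> m" and len: "length M = m" "length N = m" "length D = m"
    and pos: "\<forall>k\<in>{1..m}. entry D k \<noteq> 0" and D1: "entry D 1 = 1"
  shows "kloosterman (Suc m) M N D = kloosterman m (drop 1 M) (drop 1 N) (drop 1 D)"
proof -
  have nz: "c_coeff (Suc m) D k \<noteq> 0" if "k \<le> Suc m" for k
    using that pos by (auto simp: c_coeff_def)
  \<comment> \<open>At \<open>k = 0\<close> this says that the first entry of \<open>D\<close>,
    being 1, agrees with the boundary value of the shortened tuple.\<close>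
  have c: "c_coeff m (drop 1 D) k = c_coeff (Suc m) D (Suc k)" if "k \<le> m" for k
    using that len D1 by (auto simp: c_coeff_def entry_def)
  let ?f = "\<lambda>i. c_coeff (Suc m) D (Suc m - i) / c_coeff (Suc m) D (Suc m - i - 1)"
  let ?f' = "\<lambda>i. c_coeff m (drop 1 D) (m - i) / c_coeff m (drop 1 D) (m - i - 1)"
  have "?f i = ?f' i" if "i < m" for i
    using that c[of "m - i"] c[of "m - i - 1"] by (simp add: Suc_diff_le Suc_diff_Suc)
  moreover have "\<forall>i<m. ?f i \<noteq> 0" using nz by simp
  moreover have "?f m = 1" using D1 m by (simp add: c_coeff_def)
  ultimately interpret kloosterman_embedding "Suc m" m ?f ?f'
    "lower_corner m" "\<lambda>u. back_block m u (0\<^sub>m m 1)" "front_block m (0\<^sub>m 1 m)"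
    "rev M" N "take (m - 1) (rev M)" "drop 1 N"
    using len by (intro lower_corner_embedding) auto
  show ?thesis
    using sum_summand_eq len by (simp add: kloosterman_summand c_diag_coeff rev_drop)
qed

lemma kloosterman_butlast:
  assumes m: "1 \<le> m" and len: "length M = m" "length N = m" "length D = m"
    and pos: "\<forall>k\<in>{1..m}. entry D k \<noteq> 0" and Dm: "entry D m = 1"
  shows "kloosterman (Suc m) M N D =
    kloosterman m (take (m - 1) M) (take (m - 1) N) (take (m - 1) D)"
proof -
  have nz: "c_coeff (Suc m) D k \<noteq> 0" if "k \<le> Suc m" for k
    using that pos by (auto simp: c_coeff_def)
  \<comment> \<open>At \<open>k = m\<close> the last entry 1 of \<open>D\<close> becomes the upper
    boundary value of the shortened tuple.\<close>
  have c: "c_coeff m (take (m - 1) D) k = c_coeff (Suc m) D k" if "k \<le> m" for k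
    using that len Dm by (auto simp: c_coeff_def entry_def)
  let ?f = "\<lambda>i. c_coeff (Suc m) D (Suc m - i) / c_coeff (Suc m) D (Suc m - i - 1)"
  let ?f' = "\<lambda>i. c_coeff m (take (m - 1) D) (m - i) / c_coeff m (take (m - 1) D) (m - i - 1)"
  have "?f (Suc i) = ?f' i" if "i < m" for i
    using c[of "m - i"] c[of "m - i - 1"] by simp
  moreover have "\<forall>i<m. ?f' i \<noteq> 0"
    using c nz by simp
  moreover have "?f 0 = 1" using Dm m by (simp add: c_coeff_def)
  ultimately interpret kloosterman_embedding "Suc m" m ?f ?f'
    "upper_corner m" "front_block m (0\<^sub>m 1 m)" "\<lambda>u. back_block m u (0\<^sub>m m 1)"
    "rev M" N "drop 1 (rev M)" "take (m - 1) N"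
    using len by (intro upper_corner_embedding) auto
  show ?thesis
    using sum_summand_eq len m by (simp add: kloosterman_summand c_diag_coeff rev_take)
qed

section \<open>Removing whole initial and final runs of ones\<close>

lemma kloosterman_drop:
  assumes "a < n" and len: "length M = n - 1" "length N = n - 1" "length D = n - 1"
    and pos: "\<forall>k\<in>{1..n - 1}. entry D k \<noteq> 0" and D1: "\<forall>k\<in>{1..a}. entry D k = 1"
  shows "kloosterman n M N D = kloosterman (n - a) (drop a M) (drop a N) (drop a D)"
  using assms(1) D1
proof (induction a)
  case (Suc a)
  have e: "entry (drop a D) k = entry D (a + k)" if "1 \<le> k" "a + k \<le> n - 1" for k
    using that len by (simp add: entry_def)
  have "kloosterman n M N D = kloosterman (Suc (n - Suc a)) (drop a M) (drop a N) (drop a D)"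
    using Suc by (simp add: Suc_diff_Suc)
  also have "\<dots> = kloosterman (n - Suc a) (drop 1 (drop a M)) (drop 1 (drop a N)) (drop 1 (drop a D))"
    using Suc.prems len pos e by (intro kloosterman_drop_1) auto
  finally show ?case by simp
qed simp

lemma kloosterman_take:
  assumes "1 \<le> b" "b \<le> n" and len: "length M = n - 1" "length N = n - 1" "length D = n - 1"
    and pos: "\<forall>k\<in>{1..n - 1}. entry D k \<noteq> 0" and D1: "\<forall>k\<in>{b..n - 1}. entry D k = 1"
  shows "kloosterman n M N D = kloosterman b (take (b - 1) M) (take (b - 1) N) (take (b - 1) D)"
  using assms(2,1) D1
\<comment> \<open>Downward induction from \<open>b = n\<close>, where nothing has been removed,
  taking off one last entry per step.\<close>
proof (induction b rule: inc_induct)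
  case base
  then show ?case using len by simp
next
  case (step b)
  have e: "entry (take b D) k = entry D k" if "1 \<le> k" "k \<le> b" for k
    using that len by (simp add: entry_def)
  have "kloosterman n M N D = kloosterman (Suc b) (take b M) (take b N) (take b D)"
    using step by simp
  also have "\<dots> = kloosterman b (take (b - 1) (take b M)) (take (b - 1) (take b N)) (take (b - 1) (take b D))"
    using step.prems step.hyps len pos e by (intro kloosterman_butlast) auto
  finally show ?case by simp
qed

lemma subtuple_eq_drop_take:
  assumes "1 \<le> a" "b \<le> length X"
  shows "subtuple X a b = drop (a - 1) (take b X)"
  using assms unfolding subtuple_def
  by (intro nth_equalityI) (auto simp: entry_def simp del: upt_Suc)

text \<open>The final run is removed first, then the initial one. The bounds admit
  \<open>a = 0\<close> and \<open>b = n\<close>, where the corresponding run is empty, so that every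
  identity of the theorem is an instance.\<close>

lemma kloosterman_subtuple:
  assumes ab: "a < b" "b \<le> n" and len: "length M = n - 1" "length N = n - 1" "length D = n - 1"
    and pos: "\<forall>k\<in>{1..n - 1}. 0 < entry D k"
    and D1: "\<forall>k\<in>{1..a}. entry D k = 1" "\<forall>k\<in>{b..n - 1}. entry D k = 1"
  shows "kloosterman n M N D =
    kloosterman (b - a) (subtuple M (a + 1) (b - 1)) (subtuple N (a + 1) (b - 1)) (subtuple D (a + 1) (b - 1))"
proof -
  have e: "entry (take (b - 1) D) k = entry D k" if "1 \<le> k" "k \<le> b - 1" for k
    using that by (simp add: entry_def)
  have pos': "\<forall>k\<in>{1..n - 1}. entry D k \<noteq> 0" using pos by (auto dest!: bspec)
  have "kloosterman n M N D = kloosterman b (take (b - 1) M) (take (b - 1) N) (take (b - 1) D)"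
    using ab len pos' D1 by (intro kloosterman_take) auto
  also have "\<dots> = kloosterman (b - a) (drop a (take (b - 1) M)) (drop a (take (b - 1) N)) (drop a (take (b - 1) D))"
    using ab len pos' D1 e by (intro kloosterman_drop) auto
  finally show ?thesis using ab len by (simp add: subtuple_eq_drop_take)
qed

theorem corollary3p8:
  fixes n :: nat and M N D :: "int list"
  assumes "2 \<le> n"
    and "length M = n - 1" and "length N = n - 1" and "length D = n - 1"
    and "\<forall>k\<in>{1..n - 1}. 0 < entry D k"
  shows
    "(3 \<le> n \<and> entry D 1 = 1 \<longrightarrow>
        kloosterman n M N D =
        kloosterman (n - 1) (subtuple M 2 (n - 1)) (subtuple N 2 (n - 1)) (subtuple D 2 (n - 1)))
     \<and>
     (\<forall>i. 2 \<le> i \<and> i \<le> n - 1 \<and> (\<forall>k\<in>{i..n - 1}. entry D k = 1) \<longrightarrow>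
        kloosterman n M N D =
        kloosterman i (subtuple M 1 (i - 1)) (subtuple N 1 (i - 1)) (subtuple D 1 (i - 1)))
     \<and>
     (\<forall>i. 1 \<le> i \<and> i \<le> n - 2 \<and> (\<forall>k\<in>{1..i}. entry D k = 1) \<longrightarrow>
        kloosterman n M N D =
        kloosterman (n - i)
          (subtuple M (i + 1) (n - 1)) (subtuple N (i + 1) (n - 1)) (subtuple D (i + 1) (n - 1)))
     \<and>
     (\<forall>i j. 1 \<le> i \<and> i + 2 \<le> j \<and> j \<le> n - 1 \<and>
            (\<forall>k\<in>{1..i}. entry D k = 1) \<and> (\<forall>k\<in>{j..n - 1}. entry D k = 1) \<longrightarrow>
        kloosterman n M N D =
        kloosterman (j - i)
          (subtuple M (i + 1) (j - 1)) (subtuple N (i + 1) (j - 1)) (subtuple D (i + 1) (j - 1)))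
     \<and>
     (\<forall>i. 1 \<le> i \<and> i \<le> n - 1 \<and> (\<forall>j\<in>{1..n - 1}. j \<noteq> i \<longrightarrow> entry D j = 1) \<longrightarrow>
        kloosterman n M N D = kloosterman 2 [entry M i] [entry N i] [entry D i])"
proof -
  note sub = kloosterman_subtuple[OF _ _ assms(2-5)]
  have one: "subtuple X i i = [entry X i]" for X :: "int list" and i
    by (simp add: subtuple_def)
  show ?thesis
  proof (intro conjI allI impI; elim conjE)
    assume "3 \<le> n" "entry D 1 = 1"
    then show "kloosterman n M N D =
        kloosterman (n - 1) (subtuple M 2 (n - 1)) (subtuple N 2 (n - 1)) (subtuple D 2 (n - 1))"
      using sub[of 1 n] by (simp add: numeral_2_eq_2)
  next
    fix i assume "2 \<le> i" "i \<le> n - 1" "\<forall>k\<in>{i..n - 1}. entry D k = 1"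
    then show "kloosterman n M N D =
        kloosterman i (subtuple M 1 (i - 1)) (subtuple N 1 (i - 1)) (subtuple D 1 (i - 1))"
      using sub[of 0 i] by simp
  next
    fix i assume "1 \<le> i" "i \<le> n - 2" "\<forall>k\<in>{1..i}. entry D k = 1"
    then show "kloosterman n M N D = kloosterman (n - i)
        (subtuple M (i + 1) (n - 1)) (subtuple N (i + 1) (n - 1)) (subtuple D (i + 1) (n - 1))"
      using assms(1) by (intro sub) auto
  next
    fix i j assume "1 \<le> i" "i + 2 \<le> j" "j \<le> n - 1"
      "\<forall>k\<in>{1..i}. entry D k = 1" "\<forall>k\<in>{j..n - 1}. entry D k = 1"
    then show "kloosterman n M N D = kloosterman (j - i)
        (subtuple M (i + 1) (j - 1)) (subtuple N (i + 1) (j - 1)) (subtuple D (i + 1) (j - 1))"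
      by (intro sub) auto
  next
    \<comment> \<open>The remaining window has \<open>a = i - 1\<close> and
      \<open>b = i + 1\<close>, hence size 2 and a single entry; \<open>i = 1\<close> and
      \<open>i = n - 1\<close> are the cases with an empty run.\<close>
    fix i assume "1 \<le> i" "i \<le> n - 1" "\<forall>j\<in>{1..n - 1}. j \<noteq> i \<longrightarrow> entry D j = 1"
    moreover from this have "entry D k = 1" if "k \<in> {1..i - 1} \<union> {i + 1..n - 1}" for k
      using that by (intro \<open>\<forall>j\<in>{1..n - 1}. j \<noteq> i \<longrightarrow> entry D j = 1\<close>[rule_format]) auto
    ultimately show "kloosterman n M N D = kloosterman 2 [entry M i] [entry N i] [entry D i]"
      using sub[of "i - 1" "i + 1"] by (simp add: one)
  qed
qed

end
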